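(* Let $G$ be a finite graph and let $Z_{G}(T)$ denote the Potts model partition function of $G$ with $n$ spin states, temperature variable $T$ and Boltzmann constant $k$. Let $Z_G(p,q)$ be the dichromatic polynomial of $G$ and $H^{m,i,j}(G)$ the dichromatic homology groups of $G$. Then, with $p=-e^{\frac{-1}{kT}}$ and $q=n-1$, $Z_G(T)$ is given as a graded Euler characteristic of the dichromatic homology: $$Z_{G}(T) = Z_{G}(p,q) =\sum_{i,j} (-1)^{i} \left(e^{\frac{-1}{kT}}\right)^{i}(n-1)^{j}\, \chi (H^{\star, i,j}(G)),$$ where $\chi(H^{\star,i,j}(G))=\sum_m(-1)^m\operatorname{rank}H^{m,i,j}(G)$.
   Context: $G$ is a finite graph (multiple edges and loops allowed), $n$ is a positive integer, $T>0$, $k>0$. Potts model: $Z_{G}(T) =\sum_{\sigma} e^{\frac{-E(\sigma)}{kT}}$, the sum over all assignments $\sigma:\mathrm{Nodes}(G)\to\{1,2,\dots,n\}$, with energy $E(\sigma) = \sum_{\langle i,j \rangle} \delta(\sigma(i), \sigma(j))$, where $\langle i,j\rangle$ runs over all edges of $G$ with end nodes $i,j$, and $\delta$ is the Kronecker delta. A subgraph $S$ of $G$ here always consists of all nodes of $G$ together with a subset of the edges of $G$; $e(S)$ is its number of edges and $c(S)$ its number of connected components. The dichromatic polynomial (in variables $v=1+p$, $\lambda=1+q$) is $Z_G(p,q)=\sum_{S}(-1)^{e(S)}(1+p)^{e(S)}(1+q)^{c(S)}$. Refined enhanced states: a refined enhanced state $s$ is a subgraph $S$ together with a labeling of each connected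 component of $S$ by $1$ or $x$, and an independent labeling of each edge of $S$ by $1$ or $y$. Component labels are regarded as elements of the ring $\mathbb{Z}[x]/(x^2)$; edge labels $1,y$ are merely formal markers. For such $s$, $e(s)$ is the number of edges, $i(s)$ the number of edges labeled $y$, and $j(s)$ the number of components labeled $x$. Dichromatic complex: $C^{m,i,j}(G)$ is the free abelian group on the refined enhanced states $s$ with $e(s)=m$, $i(s)=i$, $j(s)=j$. For an edge $e$ of $G$ not in $s$, the partial differential $\partial_e(s)$ is the state obtained from $s$ by adding the edge $e$ with edge label $1$, keeping all other edge labels, and labeling components as follows: if the ends of $e$ lie in two different components of $s$ with labels $a,b$, the merged component gets label $ab\in\mathbb{Z}[x]/(x^2)$ (and $\partial_e(s)=0$ if $ab=0$, i.e. $a=b=x$); if the ends of $e$ lie in a single component with label $a$, that component keeps label $a$; all other components keep their labels. Fix an ordering of the edges of $G$ and let $d(s)=\sum_{e\in G-s}(-1)^{n(e)}\partial_e(s)$, the sum over edges $e$ of $G$ not in $s$, where $n(e)$ is the number of edges in $s$ that precede $e$. Then $d:C^{m,i,j}(G)\to C^{m+1,i,j}(G)$, $d^2=0$, and $H^{m,i,j}(G)$ denotes the kernel of $d$ on $C^{m,i,j}(G)$ modulo the image of $d$ from $C^{m-1,i,j}(G)$. *)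

theory Defs
  imports
    Complex_Main
    "HOL-Library.Uprod"
    "HOL-Library.FuncSet"
    "HOL-Library.Groups_Big_Fun"
    "HOL-Computational_Algebra.Polynomial"
    "HOL-Algebra.Free_Abelian_Groups"
begin

section \<open>Finite multigraphs\<close>

text \<open>Undirected, with multiple edges and loops: an edge is an abstract object carrying an
  unordered pair of end nodes, a loop at \<open>v\<close> having ends \<open>Upair v v\<close>.\<close>

record ('v, 'e) multigraph =
  nodes :: "'v set"
  edges :: "'e set"
  ends :: "'e \<Rightarrow> 'v uprod"

definition finite_multigraph :: "('v, 'e) multigraph \<Rightarrow> bool" where
  "finite_multigraph G \<longleftrightarrow>
     finite (nodes G) \<and> finite (edges G) \<and> (\<forall>e\<in>edges G. set_uprod (ends G e) \<subseteq> nodes G)"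

text \<open>A (spanning) subgraph is given by its edge set \<open>S \<subseteq> edges G\<close>. Its connected components
  are represented by their node sets; isolated nodes count as components.\<close>

definition adjacency :: "('v, 'e) multigraph \<Rightarrow> 'e set \<Rightarrow> ('v \<times> 'v) set" where
  "adjacency G S = {(u, v). \<exists>e\<in>S. ends G e = Upair u v}"

definition components :: "('v, 'e) multigraph \<Rightarrow> 'e set \<Rightarrow> 'v set set" where
  "components G S = nodes G // (adjacency G S)\<^sup>*"


section \<open>Potts partition function and dichromatic polynomial\<close>

definition potts_energy :: "('v, 'e) multigraph \<Rightarrow> ('v \<Rightarrow> nat) \<Rightarrow> real" where
  "potts_energy G \<sigma> =
     (\<Sum>e\<in>edges G. if \<exists>i j. ends G e = Upair i j \<and> \<sigma> i = \<sigma> j then 1 else 0)"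

definition potts_partition :: "('v, 'e) multigraph \<Rightarrow> nat \<Rightarrow> real \<Rightarrow> real \<Rightarrow> real" where
  "potts_partition G n k T =
     (\<Sum>\<sigma>\<in>nodes G \<rightarrow>\<^sub>E {1..n}. exp (- potts_energy G \<sigma> / (k * T)))"

definition dichromatic :: "('v, 'e) multigraph \<Rightarrow> real \<Rightarrow> real \<Rightarrow> real" where
  "dichromatic G p q =
     (\<Sum>S\<in>Pow (edges G). (- 1) ^ card S * (1 + p) ^ card S * (1 + q) ^ card (components G S))"


section \<open>Refined enhanced states\<close>

text \<open>The ring \<open>\<int>[x]/(x\<^sup>2)\<close> is represented by the integer polynomials of degree less than
  2, with product \<open>poly_cutoff 2 (a * b)\<close>.\<close>

definition label_x :: "int poly" where
  "label_x = [:0, 1:]"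

datatype edge_label = Edge_one | Edge_y

datatype ('v, 'e) enhanced_state =
  Enhanced_State
    (state_edges: "'e set")
    (component_label: "'v set \<Rightarrow> int poly")
    (edge_label: "'e \<Rightarrow> edge_label")

text \<open>Labelings are extensional functions, so that equal labelings give equal states.\<close>

definition enhanced_states :: "('v, 'e) multigraph \<Rightarrow> ('v, 'e) enhanced_state set" where
  "enhanced_states G =
     {s. state_edges s \<subseteq> edges G
       \<and> component_label s \<in> components G (state_edges s) \<rightarrow>\<^sub>E {1, label_x}
       \<and> edge_label s \<in> state_edges s \<rightarrow>\<^sub>E {Edge_one, Edge_y}}"

definition y_count :: "('v, 'e) enhanced_state \<Rightarrow> nat" where
  "y_count s = card {e \<in> state_edges s. edge_label s e = Edge_y}"

definition x_count :: "('v, 'e) multigraph \<Rightarrow> ('v, 'e) enhanced_state \<Rightarrow> nat" where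
  "x_count G s = card {C \<in> components G (state_edges s). component_label s C = label_x}"

definition graded_states ::
    "('v, 'e) multigraph \<Rightarrow> nat \<Rightarrow> nat \<Rightarrow> nat \<Rightarrow> ('v, 'e) enhanced_state set" where
  "graded_states G m i j =
     {s \<in> enhanced_states G. card (state_edges s) = m \<and> y_count s = i \<and> x_count G s = j}"


section \<open>The dichromatic complex\<close>

text \<open>The components of \<open>s\<close> containing an end of \<open>e\<close>: one or two of them. Taking their union
  and the product of their labels treats both cases of the partial differential at once; for a
  single component, the union and the product are that component and its label.\<close>

definition touched :: "('v, 'e) multigraph \<Rightarrow> ('v, 'e) enhanced_state \<Rightarrow> 'e \<Rightarrow> 'v set set" where
  "touched G s e = {C \<in> components G (state_edges s). C \<inter> set_uprod (ends G e) \<noteq> {}}"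

definition merged_label :: "('v, 'e) multigraph \<Rightarrow> ('v, 'e) enhanced_state \<Rightarrow> 'e \<Rightarrow> int poly" where
  "merged_label G s e = poly_cutoff 2 (\<Prod>C\<in>touched G s e. component_label s C)"

definition add_edge ::
    "('v, 'e) multigraph \<Rightarrow> ('v, 'e) enhanced_state \<Rightarrow> 'e \<Rightarrow> ('v, 'e) enhanced_state" where
  "add_edge G s e =
     Enhanced_State
       (insert e (state_edges s))
       (\<lambda>C\<in>components G (insert e (state_edges s)).
          if C = \<Union> (touched G s e) then merged_label G s e else component_label s C)
       ((edge_label s)(e := Edge_one))"

definition partial_diff ::
    "('v, 'e) multigraph \<Rightarrow> 'e \<Rightarrow> ('v, 'e) enhanced_state \<Rightarrow> ('v, 'e) enhanced_state \<Rightarrow>\<^sub>0 int" where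
  "partial_diff G e s = (if merged_label G s e = 0 then 0 else frag_of (add_edge G s e))"

text \<open>The relation \<open>r\<close> is the (reflexive) ordering of the edges.\<close>

definition preceding :: "('e \<times> 'e) set \<Rightarrow> 'e set \<Rightarrow> 'e \<Rightarrow> nat" where
  "preceding r S e = card {f \<in> S. (f, e) \<in> r \<and> f \<noteq> e}"

definition state_diff ::
    "('v, 'e) multigraph \<Rightarrow> ('e \<times> 'e) set \<Rightarrow> ('v, 'e) enhanced_state
       \<Rightarrow> ('v, 'e) enhanced_state \<Rightarrow>\<^sub>0 int" where
  "state_diff G r s =
     (\<Sum>e\<in>edges G - state_edges s.
        frag_cmul ((- 1) ^ preceding r (state_edges s) e) (partial_diff G e s))"

definition diff ::
    "('v, 'e) multigraph \<Rightarrow> ('e \<times> 'e) set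
       \<Rightarrow> (('v, 'e) enhanced_state \<Rightarrow>\<^sub>0 int) \<Rightarrow> (('v, 'e) enhanced_state \<Rightarrow>\<^sub>0 int)" where
  "diff G r = frag_extend (state_diff G r)"

definition chain_group ::
    "('v, 'e) multigraph \<Rightarrow> nat \<Rightarrow> nat \<Rightarrow> nat \<Rightarrow> (('v, 'e) enhanced_state \<Rightarrow>\<^sub>0 int) monoid" where
  "chain_group G m i j = free_Abelian_group (graded_states G m i j)"

definition cycles ::
    "('v, 'e) multigraph \<Rightarrow> ('e \<times> 'e) set \<Rightarrow> nat \<Rightarrow> nat \<Rightarrow> nat
       \<Rightarrow> (('v, 'e) enhanced_state \<Rightarrow>\<^sub>0 int) set" where
  "cycles G r m i j = kernel (chain_group G m i j) (chain_group G (Suc m) i j) (diff G r)"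

text \<open>In degree 0 the incoming differential starts at the zero group.\<close>

definition boundaries ::
    "('v, 'e) multigraph \<Rightarrow> ('e \<times> 'e) set \<Rightarrow> nat \<Rightarrow> nat \<Rightarrow> nat
       \<Rightarrow> (('v, 'e) enhanced_state \<Rightarrow>\<^sub>0 int) set" where
  "boundaries G r m i j =
     (case m of 0 \<Rightarrow> {0} | Suc l \<Rightarrow> diff G r ` carrier (chain_group G l i j))"

definition dichromatic_homology ::
    "('v, 'e) multigraph \<Rightarrow> ('e \<times> 'e) set \<Rightarrow> nat \<Rightarrow> nat \<Rightarrow> nat
       \<Rightarrow> (('v, 'e) enhanced_state \<Rightarrow>\<^sub>0 int) set monoid" where
  "dichromatic_homology G r m i j =
     subgroup_generated (chain_group G m i j) (cycles G r m i j) Mod boundaries G r m i j"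


section \<open>Rank and Euler characteristic\<close>

definition int_independent :: "('a, 'b) monoid_scheme \<Rightarrow> 'a set \<Rightarrow> bool" where
  "int_independent A B \<longleftrightarrow>
     finite B \<and> B \<subseteq> carrier A \<and>
     (\<forall>c :: 'a \<Rightarrow> int. finprod A (\<lambda>b. b [^]\<^bsub>A\<^esub> c b) B = \<one>\<^bsub>A\<^esub> \<longrightarrow> (\<forall>b\<in>B. c b = 0))"

text \<open>The rank of a commutative group: the maximal number of \<open>\<int>\<close>-linearly independent
  elements. The supremum is taken in \<open>nat\<close>, so this is meaningful only for groups of finite
  rank, in particular for finitely generated ones.\<close>

definition group_rank :: "('a, 'b) monoid_scheme \<Rightarrow> nat" where
  "group_rank A = Sup {card B |B. int_independent A B}"

text \<open>The sum over all \<open>m\<close> is \<open>Sum_any\<close>, the sum of a finitely supported family: there are no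
  states with more than \<open>card (edges G)\<close> edges.\<close>

definition homology_euler_char ::
    "('v, 'e) multigraph \<Rightarrow> ('e \<times> 'e) set \<Rightarrow> nat \<Rightarrow> nat \<Rightarrow> int" where
  "homology_euler_char G r i j =
     Sum_any (\<lambda>m. (- 1) ^ m * int (group_rank (dichromatic_homology G r m i j)))"

end

theory Submission
  imports Defs
begin

text \<open>
  Write \<open>w = exp (- 1 / (k * T))\<close>. The Boltzmann weight of a colouring is the product over all edges
  of \<open>w\<close> or \<open>1\<close>, that is, of \<open>(w - 1) * \<delta> + 1\<close>. Expanding the product gives a sum over subgraphs
  \<open>S\<close> (\<open>boltzmann_weight_expansion\<close>); the colourings that are constant on the edges of \<open>S\<close> are the
  colourings of its components, and there are \<open>n\<close> to the power \<open>c(S)\<close> of them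
  (\<open>card_monochromatic_colorings\<close>). This is the dichromatic polynomial at \<open>p = - w\<close> and
  \<open>q = n - 1\<close>.

  On the other hand, expanding \<open>(1 + p)\<close> and \<open>(1 + q)\<close> over the two labels of each edge and each
  component turns the dichromatic polynomial into a signed generating function of the enhanced
  states (\<open>dichromatic_eq_sum_states\<close>). Its coefficient in bidegree \<open>(i, j)\<close> is the alternating sum
  of the ranks of the chain groups, which equals the alternating sum of the ranks of the homology
  groups (\<open>homology_euler_char_eq\<close>).

  This last step rests on two facts. The rank, defined by independent sets of integral
  combinations, is additive along a homomorphism (\<open>rank_on_kernel_image\<close>), hence along quotients
  (\<open>group_rank_quotient\<close>). And the differential preserves the bidegree and squares to zero
  (\<open>diff_hom\<close>, \<open>diff_state_diff\<close>): the label of a component after any number of edges have been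
  added is the product of the labels of the old components it contains, cut off at degree two, so
  that adding two edges gives the same result in either order (\<open>multi_diff_comp\<close>), and the two
  signs are opposite.
\<close>

section \<open>Rank of abelian groups\<close>

text \<open>A homogeneous linear system over the integers with more unknowns than equations has a nontrivial
  solution; \<open>k b c\<close> is the coefficient of the unknown \<open>b\<close> in the equation \<open>c\<close>.\<close>

lemma integer_relation_exists:
  fixes k :: "'b \<Rightarrow> 'c \<Rightarrow> int"
  assumes "finite C" "finite B" "card C < card B"
  shows "\<exists>u. (\<exists>b\<in>B. u b \<noteq> 0) \<and> (\<forall>c\<in>C. (\<Sum>b\<in>B. u b * k b c) = 0)"
  using assms
proof (induction C arbitrary: B k rule: finite_induct)
  case empty
  then obtain b where "b \<in> B" by fastforce
  then show ?case by (intro exI[of _ "\<lambda>_. 1"]) auto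
next
  case (insert c C)
  show ?case
  proof (cases "\<forall>b\<in>B. k b c = 0")
    case True
    have "card C < card B" using insert by simp
    then obtain u where "\<exists>b\<in>B. u b \<noteq> 0" "\<forall>c\<in>C. (\<Sum>b\<in>B. u b * k b c) = 0"
      using insert.IH[of B k] insert.prems by blast
    then show ?thesis using True by (intro exI[of _ u]) auto
  next
    case False
    then obtain b0 where b0: "b0 \<in> B" "k b0 c \<noteq> 0" by blast
    define B' where "B' = B - {b0}"
    have B': "finite B'" "b0 \<notin> B'" "B = insert b0 B'" "card C < card B'"
      using insert b0 by (auto simp: B'_def)
    \<comment> \<open>Eliminate the unknown of \<open>b0\<close> by means of the equation for \<open>c\<close>.\<close>
    obtain u where u: "\<exists>b\<in>B'. u b \<noteq> 0"
      "\<forall>c'\<in>C. (\<Sum>b\<in>B'. u b * (k b0 c * k b c' - k b c * k b0 c')) = 0"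
      using insert.IH[OF B'(1,4), of "\<lambda>b c'. k b0 c * k b c' - k b c * k b0 c'"] by blast
    define v where "v b = (if b = b0 then - (\<Sum>b\<in>B'. u b * k b c) else k b0 c * u b)" for b
    have v_sum: "(\<Sum>b\<in>B. v b * k b c') =
        - (\<Sum>b\<in>B'. u b * k b c) * k b0 c' + (\<Sum>b\<in>B'. k b0 c * u b * k b c')" for c'
    proof -
      have "(\<Sum>b\<in>B'. v b * k b c') = (\<Sum>b\<in>B'. k b0 c * u b * k b c')"
        using B' by (intro sum.cong) (auto simp: v_def)
      then show ?thesis using B' by (simp add: v_def)
    qed
    have "(\<Sum>b\<in>B. v b * k b c') = 0" if "c' \<in> C" for c'
      using u(2) that unfolding v_sum
      by (auto simp: sum_distrib_left sum_distrib_right sum_subtractf algebra_simps)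
    moreover have "(\<Sum>b\<in>B. v b * k b c) = 0"
      unfolding v_sum by (simp add: sum_distrib_left sum_distrib_right algebra_simps)
    moreover have "\<exists>b\<in>B. v b \<noteq> 0"
      using u(1) b0 B' by (auto simp: v_def)
    ultimately show ?thesis by blast
  qed
qed

text \<open>The integral linear combination of the elements of \<open>B\<close> with coefficients \<open>c\<close>, in multiplicative
  notation.\<close>

abbreviation (input) lincomb :: "('a, 'b) monoid_scheme \<Rightarrow> ('a \<Rightarrow> int) \<Rightarrow> 'a set \<Rightarrow> 'a" where
  "lincomb A c B \<equiv> finprod A (\<lambda>b. b [^]\<^bsub>A\<^esub> c b) B"

text \<open>Some nonzero multiple of \<open>a\<close> is an integral combination of \<open>S\<close>; in other words, \<open>a\<close> lies in the
  rational span of \<open>S\<close>.\<close>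

definition int_depends :: "('a, 'b) monoid_scheme \<Rightarrow> 'a set \<Rightarrow> 'a \<Rightarrow> bool" where
  "int_depends A S a \<longleftrightarrow> (\<exists>n::int. n \<noteq> 0 \<and> (\<exists>c. a [^]\<^bsub>A\<^esub> n = lincomb A c S))"

text \<open>The rank of the subgroup \<open>H\<close> of \<open>A\<close>. Keeping the ambient group fixed avoids passing between the
  group structures of nested subgroups.\<close>

definition rank_on :: "('a, 'b) monoid_scheme \<Rightarrow> 'a set \<Rightarrow> nat" where
  "rank_on A H = Sup {card B |B. int_independent A B \<and> B \<subseteq> H}"

text \<open>Independent subsets of \<open>H\<close> have bounded size. Without this, the supremum of natural numbers that defines
  the rank carries no information.\<close>

definition finite_rank_on :: "('a, 'b) monoid_scheme \<Rightarrow> 'a set \<Rightarrow> bool" where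
  "finite_rank_on A H \<longleftrightarrow> (\<exists>N. \<forall>B. int_independent A B \<longrightarrow> B \<subseteq> H \<longrightarrow> card B \<le> N)"

lemma group_rank_eq_rank_on: "group_rank A = rank_on A (carrier A)"
  unfolding group_rank_def rank_on_def int_independent_def
  by (intro arg_cong[of _ _ Sup] Collect_cong) blast

lemma int_independentD:
  assumes "int_independent A B" "lincomb A c B = \<one>\<^bsub>A\<^esub>" "b \<in> B"
  shows "c b = 0"
proof -
  have "\<forall>c. lincomb A c B = \<one>\<^bsub>A\<^esub> \<longrightarrow> (\<forall>b\<in>B. c b = 0)"
    using assms(1) unfolding int_independent_def by (elim conjE)
  then have "\<forall>b\<in>B. c b = 0" using assms(2) by (elim allE[of _ c] impE)
  then show ?thesis using assms(3) by (rule bspec)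
qed

context comm_group
begin

lemma finprod_int_pow:
  assumes "finite B" "f \<in> B \<rightarrow> carrier G"
  shows "finprod G f B [^] (n::int) = finprod G (\<lambda>b. f b [^] n) B"
  using assms
proof (induction B rule: finite_induct)
  case (insert b B)
  then have "f \<in> B \<rightarrow> carrier G" "f b \<in> carrier G" by auto
  moreover from this have "(\<lambda>b. f b [^] n) \<in> B \<rightarrow> carrier G" by auto
  ultimately show ?case using insert by (simp add: int_pow_distrib)
qed simp

lemma lincomb_closed: "B \<subseteq> carrier G \<Longrightarrow> lincomb G c B \<in> carrier G"
  by (rule finprod_closed) auto

lemma lincomb_pow:
  assumes "finite B" "B \<subseteq> carrier G"
  shows "lincomb G c B [^] (n::int) = lincomb G (\<lambda>b. c b * n) B"
  using assms
  by (subst finprod_int_pow) (auto intro!: finprod_cong' simp: int_pow_pow subset_iff)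

lemma lincomb_pow_sum:
  assumes "finite B" "finite S" "S \<subseteq> carrier G"
  shows "finprod G (\<lambda>b. lincomb G (k b) S [^] (u b :: int)) B
       = lincomb G (\<lambda>s. \<Sum>b\<in>B. u b * k b s) S"
  using assms(1)
proof (induction B rule: finite_induct)
  case empty
  then show ?case by simp
next
  case (insert b B)
  have cl: "lincomb G c S \<in> carrier G" for c
    using assms by (intro lincomb_closed)
  have "finprod G (\<lambda>b. lincomb G (k b) S [^] (u b :: int)) (insert b B)
      = lincomb G (k b) S [^] u b \<otimes> lincomb G (\<lambda>s. \<Sum>b\<in>B. u b * k b s) S"
    using insert cl by (subst finprod_insert) auto
  also have "\<dots> = finprod G (\<lambda>s. s [^] (k b s * u b) \<otimes> s [^] (\<Sum>b\<in>B. u b * k b s)) S"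
    using assms by (subst lincomb_pow) (auto intro!: finprod_multf[symmetric])
  also have "\<dots> = lincomb G (\<lambda>s. \<Sum>b\<in>insert b B. u b * k b s) S"
    using insert assms
    by (intro finprod_cong') (auto simp: int_pow_mult[symmetric] mult.commute)
  finally show ?case .
qed

text \<open>Steinitz: an independent set in the rational span of \<open>S\<close> is not larger than \<open>S\<close>.\<close>

lemma card_independent_le:
  assumes "finite S" "S \<subseteq> carrier G" and ind: "int_independent G B"
    and dep: "\<And>b. b \<in> B \<Longrightarrow> int_depends G S b"
  shows "card B \<le> card S"
proof (rule ccontr)
  assume "\<not> card B \<le> card S"
  moreover have B: "finite B" "B \<subseteq> carrier G" using ind by (auto simp: int_independent_def)
  moreover from dep obtain n k where
    nk: "\<And>b. b \<in> B \<Longrightarrow> n b \<noteq> 0 \<and> b [^] (n b :: int) = lincomb G (k b) S"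
    unfolding int_depends_def by metis
  ultimately obtain u where u: "\<exists>b\<in>B. u b \<noteq> 0" "\<forall>s\<in>S. (\<Sum>b\<in>B. u b * k b s) = 0"
    using integer_relation_exists[OF assms(1), of B k] by auto
  have "lincomb G (\<lambda>b. n b * u b) B = finprod G (\<lambda>b. lincomb G (k b) S [^] u b) B"
    using B nk assms by (intro finprod_cong')
      (auto simp: int_pow_pow[symmetric] subset_iff intro!: int_pow_closed lincomb_closed)
  also have "\<dots> = lincomb G (\<lambda>s. \<Sum>b\<in>B. u b * k b s) S"
    using B assms by (intro lincomb_pow_sum)
  also have "\<dots> = \<one>"
    using u by (intro finprod_one_eqI) auto
  finally have "\<forall>b\<in>B. n b * u b = 0"
    using int_independentD[OF ind, of "\<lambda>b. n b * u b"] by simp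
  with u nk show False by auto
qed

lemma int_depends_member:
  assumes "finite B" "B \<subseteq> carrier G" "b \<in> B"
  shows "int_depends G B b"
proof -
  have "lincomb G (\<lambda>x. if x = b then 1 else 0) B = finprod G (\<lambda>x. if b = x then x else \<one>) B"
    using assms by (intro finprod_cong') (auto simp: subset_iff)
  also have "\<dots> = b"
    using assms by (intro finprod_singleton) auto
  finally show ?thesis
    unfolding int_depends_def using assms by (metis int_pow_1 subsetD zero_neq_one)
qed

lemma rank_on_eqI:
  assumes "int_independent G B" "B \<subseteq> H" "\<And>a. a \<in> H \<Longrightarrow> int_depends G B a"
  shows "rank_on G H = card B" "finite_rank_on G H"
proof -
  have "finite B" "B \<subseteq> carrier G" using assms by (auto simp: int_independent_def)
  then have le: "card B' \<le> card B" if "int_independent G B'" "B' \<subseteq> H" for B'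
    using card_independent_le[of B B'] assms that by blast
  then show "finite_rank_on G H" unfolding finite_rank_on_def by blast
  show "rank_on G H = card B"
    unfolding rank_on_def by (rule cSup_eq_maximum) (use assms le in auto)
qed

lemma maximal_independent_exists:
  assumes "finite_rank_on G H" "H \<subseteq> carrier G"
  obtains B where "int_independent G B" "B \<subseteq> H" "\<And>a. a \<in> H \<Longrightarrow> int_depends G B a"
    "rank_on G H = card B"
proof -
  obtain N where N: "\<And>B. int_independent G B \<Longrightarrow> B \<subseteq> H \<Longrightarrow> card B \<le> N"
    using assms by (auto simp: finite_rank_on_def)
  have "int_independent G {}" by (auto simp: int_independent_def)
  then obtain B where B: "int_independent G B \<and> B \<subseteq> H"
      and max: "\<And>B'. int_independent G B' \<and> B' \<subseteq> H \<Longrightarrow> card B' \<le> card B"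
    using ex_has_greatest_nat[of "\<lambda>B. int_independent G B \<and> B \<subseteq> H" "{}" card "Suc N"] N
    by (auto simp: le_imp_less_Suc)
  then have fin: "finite B" and sub: "B \<subseteq> carrier G" by (auto simp: int_independent_def)
  have dep: "int_depends G B a" if a: "a \<in> H" for a
  proof (cases "a \<in> B")
    case True
    then show ?thesis using int_depends_member fin sub by blast
  next
    case False
    have aG: "a \<in> carrier G" using a assms by auto
    \<comment> \<open>Otherwise \<open>B\<close> would not have maximal cardinality.\<close>
    have "\<not> int_independent G (insert a B)"
      using max[of "insert a B"] False a B fin by auto
    then obtain c b where c: "lincomb G c (insert a B) = \<one>" and b: "b \<in> insert a B" "c b \<noteq> 0"
      using aG fin sub unfolding int_independent_def by auto
    have cl: "lincomb G c B \<in> carrier G" using sub by (rule lincomb_closed)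
    have eq: "a [^] c a \<otimes> lincomb G c B = \<one>"
      using c False fin sub aG by (subst (asm) finprod_insert) auto
    have "c a \<noteq> 0"
    proof
      assume "c a = 0"
      with eq cl have "lincomb G c B = \<one>" by simp
      with B have "\<forall>b\<in>B. c b = 0" by (auto simp: int_independent_def)
      with b \<open>c a = 0\<close> show False by auto
    qed
    moreover have "a [^] c a = lincomb G (\<lambda>b. c b * (- 1)) B"
    proof -
      have "a [^] c a = inv (lincomb G c B)"
        using eq cl aG by (simp add: inv_equality)
      also have "\<dots> = lincomb G c B [^] (- 1 :: int)"
        using cl by (simp add: int_pow_neg)
      finally show ?thesis using fin sub by (simp add: lincomb_pow)
    qed
    ultimately show ?thesis
      unfolding int_depends_def by (intro exI[of _ "c a"] exI[of _ "\<lambda>b. c b * (- 1)"] conjI)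
  qed
  show ?thesis
    using B dep rank_on_eqI(1)[of B H] by (intro that[of B]) simp_all
qed

lemma finite_rank_on_mono:
  assumes "finite_rank_on G H" "K \<subseteq> H"
  shows "finite_rank_on G K"
proof -
  obtain N where "\<And>B. int_independent G B \<Longrightarrow> B \<subseteq> H \<Longrightarrow> card B \<le> N"
    using assms(1) unfolding finite_rank_on_def by blast
  then have "\<forall>B. int_independent G B \<longrightarrow> B \<subseteq> K \<longrightarrow> card B \<le> N"
    using subset_trans[OF _ assms(2)] by simp
  then show ?thesis unfolding finite_rank_on_def ..
qed

end

lemma hom_lincomb:
  assumes "comm_group G" "comm_group G'" "h \<in> hom G G'" "finite D" "g \<in> D \<rightarrow> carrier G"
  shows "h (finprod G (\<lambda>d. g d [^]\<^bsub>G\<^esub> (c d :: int)) D)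
    = finprod G' (\<lambda>d. h (g d) [^]\<^bsub>G'\<^esub> c d) D"
proof -
  interpret G: comm_group G by fact
  interpret G': comm_group G' by fact
  interpret group_hom G G' h using assms by unfold_locales
  show ?thesis
    using assms(4,5)
  proof (induction D rule: finite_induct)
    case (insert d D)
    then have "\<And>d. d \<in> D \<Longrightarrow> g d \<in> carrier G" "g d \<in> carrier G"
      by auto
    moreover from this have "(\<lambda>d. g d [^]\<^bsub>G\<^esub> c d) \<in> D \<rightarrow> carrier G"
      "(\<lambda>d. h (g d) [^]\<^bsub>G'\<^esub> c d) \<in> D \<rightarrow> carrier G'"
      by auto
    ultimately show ?case using insert by (simp add: hom_int_pow)
  qed simp
qed

text \<open>Rank-nullity: the union of a maximal independent set of the kernel and of lifts of a maximal
  independent set of the image is a maximal independent set.\<close>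

theorem rank_on_kernel_image:
  assumes "comm_group G" "comm_group G'" "h \<in> hom G G'" "subgroup H G" "finite_rank_on G H"
  shows "rank_on G H = rank_on G {x\<in>H. h x = \<one>\<^bsub>G'\<^esub>} + rank_on G' (h ` H)"
proof -
  interpret G: comm_group G by fact
  interpret G': comm_group G' by fact
  interpret h: group_hom G G' h using assms by unfold_locales
  interpret H: subgroup H G by fact
  define K where "K = {x\<in>H. h x = \<one>\<^bsub>G'\<^esub>}"
  have HG: "H \<subseteq> carrier G" by (rule H.subset)
  have lift: "\<exists>B. int_independent G B \<and> B \<subseteq> H \<and> card B = card D"
    if D: "int_independent G' D" "D \<subseteq> h ` H" for D
  proof -
    from D obtain g where g: "\<And>d. d \<in> D \<Longrightarrow> g d \<in> H \<and> h (g d) = d"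
      by (metis (no_types, lifting) f_inv_into_f inv_into_into subsetD)
    have fin: "finite D" using D by (auto simp: int_independent_def)
    have inj: "inj_on g D" by (metis g inj_onI)
    have "\<forall>d\<in>D. c (g d) = 0" if c: "lincomb G c (g ` D) = \<one>\<^bsub>G\<^esub>" for c
    proof -
      have "lincomb G c (g ` D) = finprod G (\<lambda>d. g d [^]\<^bsub>G\<^esub> c (g d)) D"
        using g HG inj by (intro G.finprod_reindex) auto
      then have "finprod G' (\<lambda>d. h (g d) [^]\<^bsub>G'\<^esub> c (g d)) D = \<one>\<^bsub>G'\<^esub>"
        using c hom_lincomb[OF assms(1-3) fin, of g "\<lambda>d. c (g d)"] g HG h.hom_one
        by (metis (no_types, lifting) Pi_I subsetD)
      also have "finprod G' (\<lambda>d. h (g d) [^]\<^bsub>G'\<^esub> c (g d)) D = lincomb G' (\<lambda>d. c (g d)) D"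
        using g D by (intro G'.finprod_cong') (auto simp: int_independent_def)
      finally show ?thesis using D(1) by (auto simp: int_independent_def)
    qed
    then have "int_independent G (g ` D)" using fin g HG by (auto simp: int_independent_def)
    then show ?thesis using g inj by (intro exI[of _ "g ` D"]) (auto simp: card_image)
  qed
  have fr_im: "finite_rank_on G' (h ` H)"
    using assms(5) lift unfolding finite_rank_on_def by metis
  obtain D where D: "int_independent G' D" "D \<subseteq> h ` H"
      and Ddep: "\<And>a. a \<in> h ` H \<Longrightarrow> int_depends G' D a"
      and Drank: "rank_on G' (h ` H) = card D"
    by (rule G'.maximal_independent_exists[OF fr_im]) (use HG in auto)
  have fr_K: "finite_rank_on G K"
    by (rule G.finite_rank_on_mono[OF assms(5)]) (auto simp: K_def)
  obtain B where B: "int_independent G B" "B \<subseteq> K"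
      and Bdep: "\<And>a. a \<in> K \<Longrightarrow> int_depends G B a" and Brank: "rank_on G K = card B"
    by (rule G.maximal_independent_exists[OF fr_K]) (use HG in \<open>auto simp: K_def\<close>)
  from D obtain g where g: "\<And>d. d \<in> D \<Longrightarrow> g d \<in> H \<and> h (g d) = d"
    by (metis (no_types, lifting) f_inv_into_f inv_into_into subsetD)
  have inj: "inj_on g D" by (metis g inj_onI)
  have fin: "finite B" "finite D" and BG: "B \<subseteq> carrier G" and DG: "D \<subseteq> carrier G'"
    using B D by (auto simp: int_independent_def)
  have gG: "\<And>d. d \<in> D \<Longrightarrow> g d \<in> carrier G" using g HG by auto
  have one_notin: "\<one>\<^bsub>G'\<^esub> \<notin> D"
  proof
    assume "\<one>\<^bsub>G'\<^esub> \<in> D"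
    moreover have "lincomb G' (\<lambda>x. if x = \<one>\<^bsub>G'\<^esub> then 1 else 0) D = \<one>\<^bsub>G'\<^esub>"
      by (rule G'.finprod_one_eqI) auto
    ultimately show False using D(1) unfolding int_independent_def by fastforce
  qed
  have disj: "B \<inter> g ` D = {}"
  proof -
    have False if "d \<in> D" "g d \<in> B" for d
    proof -
      from that B have "h (g d) = \<one>\<^bsub>G'\<^esub>" by (auto simp: K_def)
      with that g one_notin show False by auto
    qed
    then show ?thesis by blast
  qed
  have split: "lincomb G c (B \<union> g ` D)
      = lincomb G c B \<otimes>\<^bsub>G\<^esub> finprod G (\<lambda>d. g d [^]\<^bsub>G\<^esub> c (g d)) D" for c
    using fin disj BG gG inj
    by (subst G.finprod_Un_disjoint) (auto simp: G.finprod_reindex subset_iff Pi_iff)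
  have clB: "lincomb G c B \<in> carrier G" for c
    using BG by (rule G.lincomb_closed)
  have clD: "finprod G (\<lambda>d. g d [^]\<^bsub>G\<^esub> (c d :: int)) D \<in> carrier G" for c
    using gG by (intro G.finprod_closed) auto
  have hB: "h (lincomb G c B) = \<one>\<^bsub>G'\<^esub>" for c
  proof -
    have "h (lincomb G c B) = finprod G' (\<lambda>b. h b [^]\<^bsub>G'\<^esub> c b) B"
      using hom_lincomb[OF assms(1-3) fin(1), of "\<lambda>b. b" c] BG by auto
    also have "\<dots> = \<one>\<^bsub>G'\<^esub>"
      using B(2) by (intro G'.finprod_one_eqI) (auto simp: K_def)
    finally show ?thesis .
  qed
  have hD: "h (finprod G (\<lambda>d. g d [^]\<^bsub>G\<^esub> (c d :: int)) D) = lincomb G' c D" for c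
  proof -
    have "h (finprod G (\<lambda>d. g d [^]\<^bsub>G\<^esub> (c d :: int)) D)
        = finprod G' (\<lambda>d. h (g d) [^]\<^bsub>G'\<^esub> c d) D"
      using hom_lincomb[OF assms(1-3) fin(2), of g c] gG by auto
    also have "\<dots> = lincomb G' c D"
      using g DG by (intro G'.finprod_cong') auto
    finally show ?thesis .
  qed
  have ind: "int_independent G (B \<union> g ` D)"
    unfolding int_independent_def
  proof (intro conjI allI impI)
    fix c :: "'a \<Rightarrow> int"
    assume c: "lincomb G c (B \<union> g ` D) = \<one>\<^bsub>G\<^esub>"
    have "h (lincomb G c (B \<union> g ` D)) = lincomb G' (\<lambda>d. c (g d)) D"
      using clB clD G'.lincomb_closed[OF DG] by (simp add: split hB hD)
    with c have "lincomb G' (\<lambda>d. c (g d)) D = \<one>\<^bsub>G'\<^esub>" by simp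
    with D(1) have cD: "\<forall>d\<in>D. c (g d) = 0"
      by (auto simp: int_independent_def)
    then have "finprod G (\<lambda>d. g d [^]\<^bsub>G\<^esub> c (g d)) D = \<one>\<^bsub>G\<^esub>"
      by (intro G.finprod_one_eqI) auto
    with c clB have "lincomb G c B = \<one>\<^bsub>G\<^esub>" by (simp add: split)
    with B(1) have "\<forall>b\<in>B. c b = 0" by (auto simp: int_independent_def)
    with cD show "\<forall>b\<in>B \<union> g ` D. c b = 0" by auto
  qed (use fin BG gG in auto)
  have dep: "int_depends G (B \<union> g ` D) a" if a: "a \<in> H" for a
  proof -
    have aG: "a \<in> carrier G" using a HG by auto
    obtain n c where n: "n \<noteq> 0" "h a [^]\<^bsub>G'\<^esub> (n::int) = lincomb G' c D"
      using Ddep[of "h a"] a by (auto simp: int_depends_def)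
    define y where "y = finprod G (\<lambda>d. g d [^]\<^bsub>G\<^esub> c d) D"
    have yG: "y \<in> carrier G" unfolding y_def by (rule clD)
    have yH: "y \<in> H"
      unfolding y_def using fin(2) g
    proof (induction D rule: finite_induct)
      case (insert d D)
      then have "(\<lambda>d. g d [^]\<^bsub>G\<^esub> c d) \<in> D \<rightarrow> carrier G" "g d [^]\<^bsub>G\<^esub> c d \<in> carrier G"
        using HG by auto
      moreover have "g d [^]\<^bsub>G\<^esub> c d \<in> H"
        using insert by (intro G.subgroup_int_pow_closed[OF assms(4)]) auto
      ultimately show ?case using insert by (simp add: H.m_closed)
    qed (simp add: H.one_closed)
    \<comment> \<open>The difference between a multiple of \<open>a\<close> and a lift of its image lies in the kernel.\<close>
    define x where "x = a [^]\<^bsub>G\<^esub> n \<otimes>\<^bsub>G\<^esub> inv\<^bsub>G\<^esub> y"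
    have xH: "x \<in> H"
      unfolding x_def using a yH G.subgroup_int_pow_closed[OF assms(4) a]
      by (intro H.m_closed H.m_inv_closed) auto
    have "h x = \<one>\<^bsub>G'\<^esub>"
      using n(2) aG yG hD[of c]
      by (simp add: x_def h.hom_int_pow y_def[symmetric] G'.r_inv[OF G'.lincomb_closed[OF DG]])
    with xH have "x \<in> K" by (simp add: K_def)
    then obtain m e where m: "m \<noteq> 0" "x [^]\<^bsub>G\<^esub> (m::int) = lincomb G e B"
      using Bdep[of x] unfolding int_depends_def by blast
    have "a [^]\<^bsub>G\<^esub> n = x \<otimes>\<^bsub>G\<^esub> y"
      using aG yG by (simp add: x_def G.m_assoc)
    moreover have "x \<in> carrier G" using xH HG by auto
    ultimately have "a [^]\<^bsub>G\<^esub> (n * m) = x [^]\<^bsub>G\<^esub> m \<otimes>\<^bsub>G\<^esub> y [^]\<^bsub>G\<^esub> m"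
      by (metis G.int_pow_pow[OF aG] G.int_pow_distrib yG)
    also have "y [^]\<^bsub>G\<^esub> m = finprod G (\<lambda>d. g d [^]\<^bsub>G\<^esub> (c d * m)) D"
      unfolding y_def using gG fin
      by (subst G.finprod_int_pow) (auto intro!: G.finprod_cong' simp: G.int_pow_pow)
    finally have eq: "a [^]\<^bsub>G\<^esub> (n * m)
        = lincomb G e B \<otimes>\<^bsub>G\<^esub> finprod G (\<lambda>d. g d [^]\<^bsub>G\<^esub> (c d * m)) D"
      using m by simp
    define c' where "c' b = (if b \<in> B then e b else c (h b) * m)" for b
    have "lincomb G e B = lincomb G c' B"
      using BG by (intro G.finprod_cong') (auto simp: c'_def)
    moreover have "finprod G (\<lambda>d. g d [^]\<^bsub>G\<^esub> (c d * m)) D = finprod G (\<lambda>d. g d [^]\<^bsub>G\<^esub> c' (g d)) D"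
      using g gG disj by (intro G.finprod_cong') (auto simp: c'_def)
    ultimately have "a [^]\<^bsub>G\<^esub> (n * m) = lincomb G c' (B \<union> g ` D)"
      using eq by (simp add: split)
    then show ?thesis using n(1) m(1) unfolding int_depends_def
      by (metis mult_eq_0_iff)
  qed
  have "rank_on G H = card (B \<union> g ` D)"
    using ind dep B(2) g by (intro G.rank_on_eqI(1)) (auto simp: K_def)
  also have "\<dots> = card B + card D"
    using fin disj inj by (simp add: card_Un_disjoint card_image)
  finally show ?thesis using Brank Drank by (simp add: K_def)
qed

lemma lincomb_subgroup_generated:
  assumes "comm_group G" "subgroup H G" "finite B" "B \<subseteq> H"
  shows "lincomb (subgroup_generated G H) c B = lincomb G c B"
proof -
  interpret G: comm_group G by fact
  interpret H: subgroup H G by fact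
  interpret S: comm_group "subgroup_generated G H"
    by (rule G.abelian_subgroup_generated) fact
  show ?thesis
    using assms(3,4)
  proof (induction B rule: finite_induct)
    case (insert b B)
    then have "b \<in> carrier G" "B \<subseteq> carrier G" using H.subset by auto
    then show ?case using insert
      by (subst S.finprod_insert)
        (auto simp: subset_iff G.int_pow_subgroup_generated G.subgroup_int_pow_closed[OF assms(2)])
  qed simp
qed

lemma int_independent_subgroup_generated:
  assumes "comm_group G" "subgroup H G"
  shows "int_independent (subgroup_generated G H) B \<longleftrightarrow> int_independent G B \<and> B \<subseteq> H"
proof -
  interpret H: subgroup H G by fact
  show ?thesis
    using lincomb_subgroup_generated[OF assms] H.subset by (auto simp: int_independent_def)
qed

lemma rank_on_subgroup_generated:
  assumes "comm_group G" "subgroup H G" "K \<subseteq> H"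
  shows "rank_on (subgroup_generated G H) K = rank_on G K"
  unfolding rank_on_def int_independent_subgroup_generated[OF assms(1,2)]
  using assms(3) by (intro arg_cong[of _ _ Sup] Collect_cong) blast

text \<open>Additivity of the rank for the quotient map from \<open>Z\<close> onto \<open>Z/B\<close>.\<close>

theorem group_rank_quotient:
  assumes "comm_group G" "subgroup Z G" "subgroup B G" "B \<subseteq> Z" "finite_rank_on G Z"
  shows "rank_on G Z = rank_on G B + group_rank (subgroup_generated G Z Mod B)"
proof -
  interpret G: comm_group G by fact
  interpret Z: subgroup Z G by fact
  define A where "A = subgroup_generated G Z"
  interpret A: comm_group A
    unfolding A_def by (rule G.abelian_subgroup_generated) fact
  have [simp]: "carrier A = Z" by (simp add: A_def)
  have subB: "subgroup B A"
    unfolding A_def using assms by (intro G.subgroup_of_subgroup_generated)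
  interpret B: normal B A using subB by (rule A.subgroup_imp_normal)
  define h where "h a = B #>\<^bsub>A\<^esub> a" for a
  have "h \<in> hom A (A Mod B)" unfolding h_def by (rule B.r_coset_hom_Mod)
  moreover have "comm_group (A Mod B)" using subB by (rule A.abelian_FactGroup)
  moreover have "finite_rank_on A Z"
    using assms(5) int_independent_subgroup_generated[OF assms(1,2)]
    by (auto simp: finite_rank_on_def A_def)
  ultimately have "rank_on A Z = rank_on A {x\<in>Z. h x = \<one>\<^bsub>A Mod B\<^esub>} + rank_on (A Mod B) (h ` Z)"
    using rank_on_kernel_image[of A "A Mod B" h Z] A.subgroup_self by (simp add: A.comm_group_axioms)
  moreover have "{x\<in>Z. h x = \<one>\<^bsub>A Mod B\<^esub>} = B"
  proof (intro equalityI subsetI)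
    fix x assume x: "x \<in> {x\<in>Z. h x = \<one>\<^bsub>A Mod B\<^esub>}"
    then have "B #>\<^bsub>A\<^esub> x = B" by (simp add: h_def FactGroup_def)
    then show "x \<in> B" using x A.coset_join1[OF _ _ subB] by auto
  next
    fix x assume x: "x \<in> B"
    then have "B #>\<^bsub>A\<^esub> x = B" using assms(4) A.coset_join2[OF _ subB] by auto
    then show "x \<in> {x\<in>Z. h x = \<one>\<^bsub>A Mod B\<^esub>}"
      using x assms(4) by (auto simp: h_def FactGroup_def)
  qed
  moreover have "h ` Z = carrier (A Mod B)"
    by (auto simp: h_def FactGroup_def RCOSETS_def)
  ultimately show ?thesis
    using rank_on_subgroup_generated[OF assms(1,2)] assms(4)
    by (simp add: A_def group_rank_eq_rank_on)
qed

lemma finprod_free_Abelian_group: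
  assumes "finite I" "f \<in> I \<rightarrow> carrier (free_Abelian_group S)"
  shows "finprod (free_Abelian_group S) f I = sum f I"
proof -
  interpret comm_group "free_Abelian_group S" by (rule abelian_free_Abelian_group)
  show ?thesis
    using assms
  proof (induction I rule: finite_induct)
    case (insert i I)
    then have "f \<in> I \<rightarrow> carrier (free_Abelian_group S)" "f i \<in> carrier (free_Abelian_group S)"
      by auto
    then show ?case using insert by (subst finprod_insert) auto
  qed simp
qed

lemma rank_on_free_Abelian_group:
  assumes "finite S"
  shows "rank_on (free_Abelian_group S) (carrier (free_Abelian_group S)) = card S"
    and "finite_rank_on (free_Abelian_group S) (carrier (free_Abelian_group S))"
proof -
  interpret comm_group "free_Abelian_group S" by (rule abelian_free_Abelian_group)
  let ?B = "frag_of ` S"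
  have inj: "inj_on frag_of S" by (auto simp: inj_on_def frag_of_eq)
  have comb: "lincomb (free_Abelian_group S) c ?B = (\<Sum>s\<in>S. frag_cmul (c (frag_of s)) (frag_of s))" for c
  proof -
    have "lincomb (free_Abelian_group S) c ?B
        = (\<Sum>b\<in>?B. b [^]\<^bsub>free_Abelian_group S\<^esub> c b)"
      using assms by (intro finprod_free_Abelian_group) auto
    also have "\<dots> = (\<Sum>s\<in>S. frag_cmul (c (frag_of s)) (frag_of s))"
      using inj by (subst sum.reindex) (auto intro!: sum.cong)
    finally show ?thesis .
  qed
  have look: "poly_mapping.lookup (\<Sum>s\<in>S. frag_cmul (c s) (frag_of s)) t = (if t \<in> S then c t else 0)" for c t
    using assms by (simp add: lookup_sum if_distrib[of "\<lambda>x. _ * x"] cong: if_cong)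
  have ind: "int_independent (free_Abelian_group S) ?B"
    unfolding int_independent_def
  proof (intro conjI allI impI)
    fix c :: "_ \<Rightarrow> int"
    assume "lincomb (free_Abelian_group S) c ?B = \<one>\<^bsub>free_Abelian_group S\<^esub>"
    then have "(\<Sum>s\<in>S. frag_cmul (c (frag_of s)) (frag_of s)) = 0" by (simp add: comb)
    then have "c (frag_of t) = 0" if "t \<in> S" for t
      using look[of "\<lambda>s. c (frag_of s)" t] that by simp
    then show "\<forall>b\<in>?B. c b = 0" by auto
  qed (use assms in auto)
  have dep: "int_depends (free_Abelian_group S) ?B a" if a: "a \<in> carrier (free_Abelian_group S)" for a
  proof -
    define c where "c b = poly_mapping.lookup a (inv_into S frag_of b)" for b
    have "a = (\<Sum>s\<in>S. frag_cmul (poly_mapping.lookup a s) (frag_of s))"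
      using a by (intro poly_mapping_eqI) (auto simp: look in_keys_iff subset_iff)
    also have "\<dots> = lincomb (free_Abelian_group S) c ?B"
      unfolding comb by (intro sum.cong) (auto simp: c_def inv_into_f_f[OF inj])
    finally have "a [^]\<^bsub>free_Abelian_group S\<^esub> (1::int) = lincomb (free_Abelian_group S) c ?B"
      using a by simp
    then show ?thesis unfolding int_depends_def by (metis zero_neq_one)
  qed
  have sub: "?B \<subseteq> carrier (free_Abelian_group S)" by auto
  show "rank_on (free_Abelian_group S) (carrier (free_Abelian_group S)) = card S"
    using rank_on_eqI(1)[OF ind sub dep] by (simp add: card_image inj)
  show "finite_rank_on (free_Abelian_group S) (carrier (free_Abelian_group S))"
    using rank_on_eqI(2)[OF ind sub dep] .
qed

section \<open>Components of nested subgraphs\<close>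

text \<open>Subgraphs are given by edge sets \<open>S\<close>. When edges are added, components merge: each component of a
  larger subgraph is the union of the components of \<open>S\<close> inside it.\<close>

locale finite_graph =
  fixes G :: "('v, 'e) multigraph"
  assumes finite_G: "finite_multigraph G"
begin

lemma finite_nodes: "finite (nodes G)" and finite_edges: "finite (edges G)"
  using finite_G by (auto simp: finite_multigraph_def)

lemma edge_ends:
  assumes "e \<in> edges G"
  obtains u v where "ends G e = Upair u v" "u \<in> nodes G" "v \<in> nodes G"
proof -
  obtain u v where "ends G e = Upair u v" by (cases "ends G e") auto
  moreover from this have "u \<in> nodes G" "v \<in> nodes G"
    using finite_G assms by (auto simp: finite_multigraph_def)
  ultimately show ?thesis by (rule that)
qed

text \<open>Two nodes are related if a path of edges in \<open>S\<close> joins them. As a relation on the whole node type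
  it is reflexive also outside \<open>nodes G\<close>.\<close>

abbreviation conn :: "'e set \<Rightarrow> ('v \<times> 'v) set" where
  "conn S \<equiv> (adjacency G S)\<^sup>*"

lemma sym_conn: "sym (conn S)"
proof (rule sym_rtrancl)
  show "sym (adjacency G S)" by (force simp: sym_def adjacency_def)
qed

lemma conn_sym: "(u, v) \<in> conn S \<Longrightarrow> (v, u) \<in> conn S"
  using sym_conn by (auto dest: symD)

lemma conn_mono: "S \<subseteq> S' \<Longrightarrow> conn S \<subseteq> conn S'"
  by (rule rtrancl_mono) (auto simp: adjacency_def)

lemma components_conv: "components G S = (\<lambda>v. conn S `` {v}) ` nodes G"
  by (auto simp: components_def quotient_def)

lemma finite_components: "finite (components G S)"
  using finite_nodes by (simp add: components_conv)

lemma equiv_conn: "equiv UNIV (conn S)"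
  using sym_conn by (auto simp: equiv_def refl_rtrancl trans_rtrancl)

lemma conn_class_eq: "(u, v) \<in> conn S \<Longrightarrow> conn S `` {u} = conn S `` {v}"
  by (rule equiv_class_eq[OF equiv_conn])

lemma component_eqI:
  assumes "v \<in> C" "C \<in> components G S"
  shows "C = conn S `` {v}"
proof -
  from assms(2) obtain w where C: "C = conn S `` {w}" by (auto simp: components_conv)
  with assms(1) have "(w, v) \<in> conn S" by simp
  then show ?thesis unfolding C by (rule conn_class_eq)
qed

lemma component_nonempty: "C \<in> components G S \<Longrightarrow> C \<noteq> {}"
  by (auto simp: components_conv)

lemma components_disjoint:
  assumes "C \<in> components G S" "C' \<in> components G S" "C \<inter> C' \<noteq> {}"
  shows "C = C'"
proof -
  from assms(3) obtain v where "v \<in> C" "v \<in> C'" by blast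
  then show ?thesis using component_eqI assms(1,2) by metis
qed

lemma component_in_larger:
  assumes "D \<in> components G S" "S \<subseteq> S'"
  obtains C where "C \<in> components G S'" "D \<subseteq> C"
proof -
  from assms obtain v where "v \<in> nodes G" "D = conn S `` {v}" by (auto simp: components_conv)
  then show ?thesis
    using that[of "conn S' `` {v}"] conn_mono[OF assms(2)] by (auto simp: components_conv)
qed

lemma component_subset_iff:
  assumes "D \<in> components G S" "C \<in> components G S'" "S \<subseteq> S'"
  shows "D \<subseteq> C \<longleftrightarrow> D \<inter> C \<noteq> {}"
proof
  assume "D \<inter> C \<noteq> {}"
  obtain C' where "C' \<in> components G S'" "D \<subseteq> C'"
    using component_in_larger assms by blast
  with \<open>D \<inter> C \<noteq> {}\<close> show "D \<subseteq> C"
    using components_disjoint[of C S' C'] assms by blast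
qed (use component_nonempty[OF assms(1)] in blast)

text \<open>The components of \<open>S\<close> contained in the node set \<open>C\<close>, usually a component of a larger subgraph.\<close>

definition inside :: "'e set \<Rightarrow> 'v set \<Rightarrow> 'v set set" where
  "inside S C = {D \<in> components G S. D \<subseteq> C}"

lemma finite_inside: "finite (inside S C)"
  by (simp add: inside_def finite_components)

lemma inside_self: "C \<in> components G S \<Longrightarrow> inside S C = {C}"
proof (intro equalityI subsetI)
  fix D assume "C \<in> components G S" "D \<in> inside S C"
  then have "D \<in> components G S" "C \<in> components G S" "D \<inter> C \<noteq> {}"
    using component_nonempty[of D S] by (auto simp: inside_def)
  then have "D = C" by (rule components_disjoint)
  then show "D \<in> {C}" by simp
qed (auto simp: inside_def)

lemma inside_disjoint:
  assumes "C \<in> components G S'" "C' \<in> components G S'" "C \<noteq> C'"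
  shows "inside S C \<inter> inside S C' = {}"
proof -
  have "C \<inter> C' = {}" using assms components_disjoint[of C S' C'] by blast
  then have "D \<in> components G S \<Longrightarrow> D \<subseteq> C \<Longrightarrow> D \<subseteq> C' \<Longrightarrow> False" for D
    using component_nonempty[of D S] by blast
  then show ?thesis by (auto simp: inside_def)
qed

lemma inside_trans:
  assumes "S \<subseteq> S'" "S' \<subseteq> S''" "C \<in> components G S''"
  shows "inside S C = (\<Union>C'\<in>inside S' C. inside S C')"
proof (intro equalityI subsetI)
  fix D assume D: "D \<in> inside S C"
  then have "D \<in> components G S" by (simp add: inside_def)
  then obtain C' where C': "C' \<in> components G S'" "D \<subseteq> C'"
    by (rule component_in_larger[OF _ assms(1)])
  then have "C' \<subseteq> C"
    using D component_nonempty[of D S] component_subset_iff[OF C'(1) assms(3,2)]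
    by (auto simp: inside_def)
  with C' D show "D \<in> (\<Union>C'\<in>inside S' C. inside S C')" by (auto simp: inside_def)
qed (auto simp: inside_def)

lemma components_eq_Union_inside:
  assumes "S \<subseteq> S'"
  shows "components G S = (\<Union>C\<in>components G S'. inside S C)"
proof (intro equalityI subsetI)
  fix D assume D: "D \<in> components G S"
  then obtain C where "C \<in> components G S'" "D \<subseteq> C" by (rule component_in_larger[OF _ assms])
  with D show "D \<in> (\<Union>C\<in>components G S'. inside S C)" by (auto simp: inside_def)
qed (auto simp: inside_def)

lemma adjacency_insert:
  "ends G e = Upair u v \<Longrightarrow> adjacency G (insert e S) = adjacency G S \<union> {(u, v), (v, u)}"
  by (auto simp: adjacency_def)

text \<open>Adding an edge joins the components of its ends and changes no other component. A loop and an edge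
  within a component are included: then \<open>M\<close> is a single component.\<close>

lemma conn_insert:
  fixes S :: "'e set"
  assumes "ends G e = Upair u v"
  defines "M \<equiv> conn S `` {u} \<union> conn S `` {v}"
  shows "(a, b) \<in> conn (insert e S) \<longleftrightarrow> (a, b) \<in> conn S \<or> a \<in> M \<and> b \<in> M"
proof
  assume "(a, b) \<in> conn (insert e S)"
  then show "(a, b) \<in> conn S \<or> a \<in> M \<and> b \<in> M"
  proof (induction rule: rtrancl_induct)
    case (step y z)
    from step.hyps(2) consider "(y, z) \<in> adjacency G S" | "y \<in> M" "z \<in> M"
      unfolding adjacency_insert[OF assms(1)] by (auto simp: M_def)
    then show ?case
    proof cases
      case 1
      then have "y \<in> M \<Longrightarrow> z \<in> M" by (auto simp: M_def intro: rtrancl_into_rtrancl)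
      with 1 step.IH show ?thesis by (auto intro: rtrancl_into_rtrancl)
    next
      case 2
      have "a \<in> M" if "(a, y) \<in> conn S"
        using conn_sym[OF that] 2(1) by (auto simp: M_def intro: rtrancl_trans)
      with 2 step.IH show ?thesis by blast
    qed
  qed simp
next
  have sub: "conn S \<subseteq> conn (insert e S)" by (rule conn_mono) auto
  have uv: "(u, v) \<in> conn (insert e S)"
    by (rule r_into_rtrancl) (simp add: adjacency_insert[OF assms(1)])
  have M: "(u, a) \<in> conn (insert e S)" if "a \<in> M" for a
    using that sub uv by (auto simp: M_def intro: rtrancl_trans)
  assume "(a, b) \<in> conn S \<or> a \<in> M \<and> b \<in> M"
  then show "(a, b) \<in> conn (insert e S)"
    using sub M[of a] M[of b] conn_sym[of u a] by (auto intro: rtrancl_trans[of a u])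
qed

end

section \<open>Products of component labels\<close>

lemma poly_cutoff_mult_left: "poly_cutoff n (poly_cutoff n p * q) = poly_cutoff n (p * q)"
  for p q :: "'a :: comm_semiring_1 poly"
  by (auto simp: poly_eq_iff coeff_poly_cutoff coeff_mult intro!: sum.cong)

lemma poly_cutoff_prod:
  "finite A \<Longrightarrow> poly_cutoff n (\<Prod>a\<in>A. poly_cutoff n (f a)) = poly_cutoff n (\<Prod>a\<in>A. f a)"
  for f :: "'b \<Rightarrow> 'a :: comm_semiring_1 poly"
proof (induction A rule: finite_induct)
  case (insert a A)
  have "poly_cutoff n (poly_cutoff n (f a) * (\<Prod>a\<in>A. poly_cutoff n (f a)))
      = poly_cutoff n ((\<Prod>a\<in>A. poly_cutoff n (f a)) * f a)"
    by (simp add: poly_cutoff_mult_left mult.commute)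
  also have "\<dots> = poly_cutoff n (poly_cutoff n (\<Prod>a\<in>A. poly_cutoff n (f a)) * f a)"
    by (rule poly_cutoff_mult_left[symmetric])
  also have "\<dots> = poly_cutoff n ((\<Prod>a\<in>A. f a) * f a)"
    unfolding insert.IH by (rule poly_cutoff_mult_left)
  finally show ?case using insert.hyps by (simp add: mult.commute)
qed simp

lemma label_x_eq_monom: "label_x = monom 1 1"
  by (simp add: label_x_def monom_altdef)

lemma label_x_neq_1: "label_x \<noteq> 1"
  by (simp add: label_x_def one_pCons)

lemma label_x_neq_0: "label_x \<noteq> 0"
  by (simp add: label_x_def)

lemma poly_cutoff_label: "p \<in> {1, label_x} \<Longrightarrow> poly_cutoff 2 p = p"
  by (auto simp: poly_eq_iff coeff_poly_cutoff label_x_eq_monom)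

text \<open>In \<open>\<int>[x]/(x\<^sup>2)\<close>, a product of labels vanishes as soon as two factors are \<open>x\<close>.\<close>

lemma cutoff_prod_labels:
  assumes "finite A" "\<And>D. D \<in> A \<Longrightarrow> l D \<in> {1, label_x}"
  defines "k \<equiv> card {D \<in> A. l D = label_x}"
  shows "poly_cutoff 2 (\<Prod>D\<in>A. l D) = (if k = 0 then 1 else if k = 1 then label_x else 0)"
proof -
  have "(\<Prod>D\<in>A. l D) = (\<Prod>D\<in>A. if l D = label_x then label_x else 1)"
    using assms(2) by (intro prod.cong) auto
  also have "\<dots> = label_x ^ k"
    using assms(1) by (simp add: k_def prod.If_cases Int_def conj_commute)
  also have "\<dots> = monom 1 k"
    by (simp add: label_x_eq_monom monom_power)
  finally show ?thesis
    by (auto simp: poly_eq_iff coeff_poly_cutoff label_x_eq_monom)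
qed

section \<open>Adding edges to a state\<close>

context finite_graph
begin

text \<open>The label that the component \<open>C\<close> of a larger subgraph inherits from a labelling \<open>l\<close> of the
  components of \<open>S\<close>: the product in \<open>\<int>[x]/(x\<^sup>2)\<close> of the labels of the components that it contains.\<close>

definition pushed_label :: "'e set \<Rightarrow> ('v set \<Rightarrow> int poly) \<Rightarrow> 'v set \<Rightarrow> int poly" where
  "pushed_label S l C = poly_cutoff 2 (\<Prod>D\<in>inside S C. l D)"

text \<open>Pushing labels forward in two steps is the same as pushing them forward in one step. All
  compatibility of the partial differentials comes from here.\<close>

lemma pushed_label_trans:
  assumes "S \<subseteq> S'" "S' \<subseteq> S''" "C \<in> components G S''"
  shows "poly_cutoff 2 (\<Prod>C'\<in>inside S' C. pushed_label S l C') = pushed_label S l C"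
proof -
  have "poly_cutoff 2 (\<Prod>C'\<in>inside S' C. pushed_label S l C')
      = poly_cutoff 2 (\<Prod>C'\<in>inside S' C. \<Prod>D\<in>inside S C'. l D)"
    unfolding pushed_label_def by (intro poly_cutoff_prod finite_inside)
  also have "(\<Prod>C'\<in>inside S' C. \<Prod>D\<in>inside S C'. l D) = (\<Prod>D\<in>inside S C. l D)"
    unfolding inside_trans[OF assms]
  proof (rule prod.UNION_disjoint[symmetric])
    show "\<forall>C'\<in>inside S' C. \<forall>C''\<in>inside S' C. C' \<noteq> C'' \<longrightarrow> inside S C' \<inter> inside S C'' = {}"
    proof (intro ballI impI)
      fix C' C'' assume "C' \<in> inside S' C" "C'' \<in> inside S' C" "C' \<noteq> C''"
      then show "inside S C' \<inter> inside S C'' = {}"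
        using inside_disjoint[of C' S' C'' S] by (simp add: inside_def[of S'])
    qed
  qed (auto simp: finite_inside)
  finally show ?thesis by (simp add: pushed_label_def)
qed

text \<open>The state obtained by adding all edges of \<open>A\<close>, with edge label \<open>1\<close>. Unlike iterated addition of
  single edges it does not refer to an order on \<open>A\<close>.\<close>

definition add_edges :: "'e set \<Rightarrow> ('v, 'e) enhanced_state \<Rightarrow> ('v, 'e) enhanced_state" where
  "add_edges A s =
     Enhanced_State
       (state_edges s \<union> A)
       (\<lambda>C\<in>components G (state_edges s \<union> A). pushed_label (state_edges s) (component_label s) C)
       (\<lambda>e. if e \<in> A then Edge_one else edge_label s e)"

text \<open>The simultaneous partial differential along all edges of \<open>A\<close>; it is zero if some component of the
  result gets label zero.\<close>

definition multi_diff :: "'e set \<Rightarrow> ('v, 'e) enhanced_state \<Rightarrow> ('v, 'e) enhanced_state \<Rightarrow>\<^sub>0 int" where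
  "multi_diff A s =
     (if \<exists>C\<in>components G (state_edges s \<union> A). pushed_label (state_edges s) (component_label s) C = 0
      then 0 else frag_of (add_edges A s))"

lemma component_label_cases:
  "s \<in> enhanced_states G \<Longrightarrow> C \<in> components G (state_edges s) \<Longrightarrow> component_label s C \<in> {1, label_x}"
  by (auto simp: enhanced_states_def PiE_iff)

lemma state_edges_subset: "s \<in> enhanced_states G \<Longrightarrow> state_edges s \<subseteq> edges G"
  by (simp add: enhanced_states_def)

text \<open>\<open>U\<close> is the component created by adding \<open>e\<close>; for the last claim, every other component was already
  present.\<close>

lemma touched_eq_inside:
  fixes S :: "'e set"
  assumes "S = state_edges s" "ends G e = Upair u v" "u \<in> nodes G" "v \<in> nodes G"
  defines "U \<equiv> conn (insert e S) `` {u}"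
  shows "touched G s e = inside S U" "\<Union> (touched G s e) = U" "U \<in> components G (insert e S)"
    "\<And>C. C \<in> components G (insert e S) \<Longrightarrow> C \<noteq> U \<Longrightarrow> C \<in> components G S"
proof -
  define M where "M = conn S `` {u} \<union> conn S `` {v}"
  have ci: "(a, b) \<in> conn (insert e S) \<longleftrightarrow> (a, b) \<in> conn S \<or> a \<in> M \<and> b \<in> M" for a b
    unfolding M_def by (rule conn_insert) fact
  have U: "U = M" unfolding U_def using ci by (auto simp: M_def)
  show UC: "U \<in> components G (insert e S)" using assms by (auto simp: components_conv)
  have "touched G s e = {conn S `` {u}, conn S `` {v}}"
  proof (intro equalityI subsetI)
    fix C assume "C \<in> touched G s e"
    then have "C \<in> components G S" "u \<in> C \<or> v \<in> C" using assms(1,2) by (auto simp: touched_def)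
    then show "C \<in> {conn S `` {u}, conn S `` {v}}"
      using component_eqI[of u C S] component_eqI[of v C S] by blast
  qed (use assms in \<open>auto simp: touched_def components_conv\<close>)
  moreover have "inside S U = {conn S `` {u}, conn S `` {v}}"
  proof (intro equalityI subsetI)
    fix D assume D: "D \<in> inside S U"
    then have DC: "D \<in> components G S" "D \<subseteq> M" by (auto simp: inside_def U)
    then obtain d where "d \<in> D" "d \<in> M" using component_nonempty by blast
    then have "D = conn S `` {d}" using DC component_eqI by blast
    with \<open>d \<in> M\<close> show "D \<in> {conn S `` {u}, conn S `` {v}}"
      using conn_class_eq[of u d S] conn_class_eq[of v d S] by (auto simp: M_def)
  next
    fix D assume "D \<in> {conn S `` {u}, conn S `` {v}}"
    then show "D \<in> inside S U" using assms(3,4) unfolding U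
      by (auto simp: M_def inside_def components_conv)
  qed
  ultimately show "touched G s e = inside S U" "\<Union> (touched G s e) = U"
    using U by (auto simp: M_def)
  fix C assume C: "C \<in> components G (insert e S)" "C \<noteq> U"
  then obtain w where w: "w \<in> nodes G" "C = conn (insert e S) `` {w}" by (auto simp: components_conv)
  have "w \<notin> M"
  proof
    assume "w \<in> M"
    then have "U = C" unfolding w(2) by (intro component_eqI UC) (simp add: U)
    with C(2) show False by simp
  qed
  then have "C = conn S `` {w}" using w ci by auto
  then show "C \<in> components G S" using w by (auto simp: components_conv)
qed

lemma pushed_label_unchanged:
  assumes "s \<in> enhanced_states G" "C \<in> components G (state_edges s)"
  shows "pushed_label (state_edges s) (component_label s) C = component_label s C"
  using component_label_cases[OF assms] assms(2)
  by (simp add: pushed_label_def inside_self poly_cutoff_label)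

lemma merged_label_eq:
  assumes "ends G e = Upair u v" "u \<in> nodes G" "v \<in> nodes G"
  shows "merged_label G s e
    = pushed_label (state_edges s) (component_label s) (conn (insert e (state_edges s)) `` {u})"
  using touched_eq_inside(1)[OF refl assms] by (simp add: merged_label_def pushed_label_def)

lemma add_edge_eq_add_edges:
  assumes "s \<in> enhanced_states G" "e \<in> edges G"
  shows "add_edge G s e = add_edges {e} s"
proof -
  obtain u v where uv: "ends G e = Upair u v" "u \<in> nodes G" "v \<in> nodes G"
    by (rule edge_ends[OF assms(2)])
  let ?S = "state_edges s" and ?l = "component_label s"
  note t = touched_eq_inside[OF refl[of ?S] uv]
  have "(if C = \<Union> (touched G s e) then merged_label G s e else ?l C) = pushed_label ?S ?l C"
    if C: "C \<in> components G (insert e ?S)" for C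
  proof (cases "C = \<Union> (touched G s e)")
    case True
    then show ?thesis unfolding t(2) by (simp add: merged_label_eq[OF uv])
  next
    case False
    then have "C \<in> components G ?S" using t(4)[OF C] unfolding t(2) by blast
    then show ?thesis using False by (simp add: pushed_label_unchanged[OF assms(1)])
  qed
  then have "restrict (\<lambda>C. if C = \<Union> (touched G s e) then merged_label G s e else ?l C)
      (components G (insert e ?S)) = restrict (pushed_label ?S ?l) (components G (insert e ?S))"
    by (rule restrict_ext)
  then show ?thesis
    unfolding add_edge_def add_edges_def by (simp add: fun_upd_def)
qed

lemma partial_diff_eq_multi_diff:
  assumes "s \<in> enhanced_states G" "e \<in> edges G"
  shows "partial_diff G e s = multi_diff {e} s"
proof -
  obtain u v where uv: "ends G e = Upair u v" "u \<in> nodes G" "v \<in> nodes G"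
    by (rule edge_ends[OF assms(2)])
  let ?S = "state_edges s" and ?l = "component_label s"
  note t = touched_eq_inside[OF refl[of ?S] uv]
  have "merged_label G s e = 0 \<longleftrightarrow> (\<exists>C\<in>components G (insert e ?S). pushed_label ?S ?l C = 0)"
  proof
    assume "merged_label G s e = 0"
    then show "\<exists>C\<in>components G (insert e ?S). pushed_label ?S ?l C = 0"
      using t(3) merged_label_eq[OF uv] by auto
  next
    assume "\<exists>C\<in>components G (insert e ?S). pushed_label ?S ?l C = 0"
    then obtain C where C: "C \<in> components G (insert e ?S)" "pushed_label ?S ?l C = 0" by blast
    then have "C \<notin> components G ?S"
      using pushed_label_unchanged[OF assms(1), of C] component_label_cases[OF assms(1), of C]
        label_x_neq_0 by auto
    with C t(4) show "merged_label G s e = 0" using merged_label_eq[OF uv] by auto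
  qed
  then show ?thesis
    by (simp add: partial_diff_def multi_diff_def add_edge_eq_add_edges[OF assms])
qed

lemma pushed_label_eq:
  assumes "s \<in> enhanced_states G"
  defines "k C \<equiv> card {D \<in> inside (state_edges s) C. component_label s D = label_x}"
  shows "pushed_label (state_edges s) (component_label s) C
    = (if k C = 0 then 1 else if k C = 1 then label_x else 0)"
  unfolding pushed_label_def k_def
  using component_label_cases[OF assms(1)] by (intro cutoff_prod_labels finite_inside) (auto simp: inside_def)

text \<open>No \<open>x\<close> is lost or created: each new component with nonzero label contains at most one old
  component labelled \<open>x\<close>, and is labelled \<open>x\<close> exactly if it contains one.\<close>

lemma add_edges_graded:
  assumes s: "s \<in> graded_states G m i j" and A: "finite A" "A \<subseteq> edges G" "A \<inter> state_edges s = {}"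
    and nz: "\<And>C. C \<in> components G (state_edges s \<union> A) \<Longrightarrow>
      pushed_label (state_edges s) (component_label s) C \<noteq> 0"
  shows "add_edges A s \<in> graded_states G (m + card A) i j"
proof -
  let ?S = "state_edges s" and ?l = "component_label s"
  have st: "s \<in> enhanced_states G" using s by (simp add: graded_states_def)
  have fS: "finite ?S" using state_edges_subset[OF st] finite_edges by (rule finite_subset)
  define k where "k C = card {D \<in> inside ?S C. ?l D = label_x}" for C
  have pk: "pushed_label ?S ?l C = (if k C = 0 then 1 else if k C = 1 then label_x else 0)" for C
    unfolding k_def by (rule pushed_label_eq[OF st])
  have lab: "edge_label s \<in> ?S \<rightarrow>\<^sub>E {Edge_one, Edge_y}" using st by (simp add: enhanced_states_def)
  have val: "pushed_label ?S ?l C \<in> {1, label_x}" if "C \<in> components G (?S \<union> A)" for C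
    using nz[OF that] by (auto simp: pk split: if_splits)
  have "add_edges A s \<in> enhanced_states G"
    using st A(2) val lab
    by (auto simp: enhanced_states_def add_edges_def PiE_iff extensional_def)
  moreover have "card (state_edges (add_edges A s)) = m + card A"
    using s fS A by (simp add: add_edges_def graded_states_def card_Un_disjoint Int_commute)
  moreover have "y_count (add_edges A s) = i"
  proof -
    have "{e \<in> ?S \<union> A. (if e \<in> A then Edge_one else edge_label s e) = Edge_y}
        = {e \<in> ?S. edge_label s e = Edge_y}"
      using A(3) by auto
    then show ?thesis using s by (simp add: y_count_def add_edges_def graded_states_def)
  qed
  moreover have "x_count G (add_edges A s) = j"
  proof -
    let ?K = "components G (?S \<union> A)"
    have k1: "k C = 0 \<or> k C = 1" if "C \<in> ?K" for C
      using nz[OF that] by (auto simp: pk split: if_splits)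
    have "x_count G (add_edges A s) = card {C \<in> ?K. k C = 1}"
      unfolding x_count_def add_edges_def
      using label_x_neq_1 label_x_neq_0 k1 by (intro arg_cong[of _ _ card]) (auto simp: pk)
    also have "\<dots> = (\<Sum>C\<in>?K. if k C = 1 then 1 else 0)"
      using finite_components by (simp add: sum.If_cases Int_def)
    also have "\<dots> = (\<Sum>C\<in>?K. k C)"
      using k1 by (intro sum.cong) auto
    also have "\<dots> = card (\<Union>C\<in>?K. {D \<in> inside ?S C. ?l D = label_x})"
      unfolding k_def
    proof (rule card_UN_disjoint[symmetric])
      show "\<forall>C\<in>?K. \<forall>C'\<in>?K. C \<noteq> C' \<longrightarrow>
          {D \<in> inside ?S C. ?l D = label_x} \<inter> {D \<in> inside ?S C'. ?l D = label_x} = {}"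
      proof (intro ballI impI)
        fix C C' assume "C \<in> ?K" "C' \<in> ?K" "C \<noteq> C'"
        then have "inside ?S C \<inter> inside ?S C' = {}" by (rule inside_disjoint)
        then show "{D \<in> inside ?S C. ?l D = label_x} \<inter> {D \<in> inside ?S C'. ?l D = label_x} = {}"
          by blast
      qed
    qed (auto simp: finite_components finite_inside)
    also have "(\<Union>C\<in>?K. {D \<in> inside ?S C. ?l D = label_x}) = {D \<in> components G ?S. ?l D = label_x}"
      using components_eq_Union_inside[of ?S "?S \<union> A"] by auto
    finally show ?thesis using s by (simp add: x_count_def graded_states_def)
  qed
  ultimately show ?thesis by (simp add: graded_states_def)
qed

lemma keys_multi_diff:
  assumes "s \<in> graded_states G m i j" "finite A" "A \<subseteq> edges G" "A \<inter> state_edges s = {}"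
  shows "Poly_Mapping.keys (multi_diff A s) \<subseteq> graded_states G (m + card A) i j"
  using add_edges_graded[OF assms] by (auto simp: multi_diff_def keys_frag_of)

text \<open>The right-hand side is symmetric in \<open>e\<close> and \<open>f\<close>, so the partial differentials commute.\<close>

lemma multi_diff_comp:
  assumes s: "s \<in> enhanced_states G" and ef: "e \<in> edges G - state_edges s"
    "f \<in> edges G - state_edges s" "e \<noteq> f"
  shows "frag_extend (partial_diff G f) (partial_diff G e s) = multi_diff {e, f} s"
proof -
  let ?S = "state_edges s" and ?l = "component_label s"
  let ?S1 = "insert e ?S" and ?S2 = "?S \<union> {e, f}"
  have P: "partial_diff G e s = multi_diff {e} s"
    using s ef by (intro partial_diff_eq_multi_diff) auto
  have trans: "poly_cutoff 2 (\<Prod>C'\<in>inside ?S1 C. pushed_label ?S ?l C') = pushed_label ?S ?l C"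
    if "C \<in> components G ?S2" for C
    using that by (intro pushed_label_trans[of _ _ ?S2]) auto
  show ?thesis
  proof (cases "\<exists>C\<in>components G ?S1. pushed_label ?S ?l C = 0")
    case True
    then obtain C' where C': "C' \<in> components G ?S1" "pushed_label ?S ?l C' = 0" by blast
    then obtain C where C: "C \<in> components G ?S2" "C' \<subseteq> C"
      using component_in_larger[of C' ?S1 ?S2] by auto
    then have "pushed_label ?S ?l C = 0"
      using trans[OF C(1)] C' finite_inside by (subst (asm) prod_zero) (auto simp: inside_def)
    with C have "multi_diff {e, f} s = 0" by (auto simp: multi_diff_def)
    moreover have "multi_diff {e} s = 0" using True by (simp add: multi_diff_def)
    ultimately show ?thesis by (simp add: P)
  next
    case False
    let ?t = "add_edges {e} s"
    have Pe: "multi_diff {e} s = frag_of ?t" using False by (simp add: multi_diff_def)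
    have t: "?t \<in> enhanced_states G"
    proof -
      have "s \<in> graded_states G (card ?S) (y_count s) (x_count G s)"
        using s by (simp add: graded_states_def)
      then have "?t \<in> graded_states G (card ?S + card {e}) (y_count s) (x_count G s)"
        using False ef by (intro add_edges_graded) auto
      then show ?thesis by (simp add: graded_states_def)
    qed
    have S: "state_edges ?t = ?S1" "?S1 \<union> {f} = ?S2"
      by (auto simp: add_edges_def)
    have push: "pushed_label ?S1 (component_label ?t) C = pushed_label ?S ?l C"
      if "C \<in> components G ?S2" for C
    proof -
      have "(\<Prod>C'\<in>inside ?S1 C. component_label ?t C') = (\<Prod>C'\<in>inside ?S1 C. pushed_label ?S ?l C')"
        by (intro prod.cong) (auto simp: inside_def add_edges_def)
      then show ?thesis using trans[OF that] by (simp add: pushed_label_def[of ?S1])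
    qed
    have "add_edges {f} ?t = add_edges {e, f} s"
      unfolding add_edges_def[of "{f}"] add_edges_def[of "{e, f}"] S
      using push by (auto simp: add_edges_def fun_eq_iff restrict_def)
    then have "multi_diff {f} ?t = multi_diff {e, f} s"
      unfolding multi_diff_def[of "{f}"] multi_diff_def[of "{e, f}"] S
      using push by (simp cong: bex_cong)
    then show ?thesis
      using t ef by (simp add: P Pe partial_diff_eq_multi_diff)
  qed
qed

section \<open>The differential\<close>

lemma preceding_insert:
  assumes "finite S" "e \<notin> S" "e \<noteq> f"
  shows "preceding r (insert e S) f = preceding r S f + (if (e, f) \<in> r then 1 else 0)"
proof -
  have "{g \<in> insert e S. (g, f) \<in> r \<and> g \<noteq> f}
      = (if (e, f) \<in> r then insert e {g \<in> S. (g, f) \<in> r \<and> g \<noteq> f} else {g \<in> S. (g, f) \<in> r \<and> g \<noteq> f})"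
    using assms by auto
  then show ?thesis using assms by (simp add: preceding_def)
qed

lemma eq_uminus_imp_zero: "x = - x \<Longrightarrow> x = 0" for x :: "'a \<Rightarrow>\<^sub>0 int"
proof (rule poly_mapping_eqI)
  fix k assume "x = - x"
  then have "poly_mapping.lookup x k = - poly_mapping.lookup x k"
    by (metis lookup_uminus)
  then show "poly_mapping.lookup x k = poly_mapping.lookup 0 k" by simp
qed

text \<open>The double sum over ordered pairs of distinct added edges is antisymmetric: the partial
  differentials commute, while exactly one of the two orders of insertion picks up an extra sign.\<close>

lemma diff_state_diff:
  assumes s: "s \<in> enhanced_states G" and r: "linear_order_on (edges G) r"
  shows "diff G r (state_diff G r s) = 0"
proof -
  let ?S = "state_edges s"
  let ?X = "edges G - ?S"
  define sg :: "'e set \<Rightarrow> 'e \<Rightarrow> int" where "sg S e = (- 1) ^ preceding r S e" for S e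
  \<comment> \<open>The summand of the pair \<open>(e, f)\<close>, set to zero on the diagonal so that both sums run over \<open>?X\<close>.\<close>
  define F where "F e f = (if e = f then 0
      else frag_cmul (sg ?S e * sg (insert e ?S) f) (multi_diff {e, f} s))" for e f
  have fX: "finite ?X" using finite_edges by simp
  have fS: "finite ?S" using state_edges_subset[OF s] finite_edges by (rule finite_subset)
  have inner: "frag_extend (state_diff G r) (partial_diff G e s)
      = (\<Sum>f\<in>?X - {e}. frag_cmul (sg (insert e ?S) f) (multi_diff {e, f} s))" if e: "e \<in> ?X" for e
  proof -
    have *: "frag_extend (partial_diff G f) (partial_diff G e s) = multi_diff {e, f} s"
      if "f \<in> ?X - {e}" for f
      using that e s by (intro multi_diff_comp) auto
    show ?thesis
    proof (cases "partial_diff G e s = 0")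
      case True
      then show ?thesis using * by simp
    next
      case False
      then have t: "partial_diff G e s = frag_of (add_edge G s e)"
        by (auto simp: partial_diff_def split: if_splits)
      have "edges G - insert e ?S = ?X - {e}" by auto
      then show ?thesis using *
        by (simp add: t state_diff_def sg_def add_edge_def)
    qed
  qed
  have "diff G r (state_diff G r s)
      = (\<Sum>e\<in>?X. frag_cmul (sg ?S e) (frag_extend (state_diff G r) (partial_diff G e s)))"
    unfolding diff_def state_diff_def[of G r s] using fX
    by (simp add: frag_extend_sum frag_extend_cmul sg_def o_def)
  also have "\<dots> = (\<Sum>e\<in>?X. \<Sum>f\<in>?X. F e f)"
  proof (rule sum.cong)
    fix e assume e: "e \<in> ?X"
    have "(\<Sum>f\<in>?X. F e f) = (\<Sum>f\<in>?X - {e}. F e f)"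
      using fX by (intro sum.mono_neutral_right) (auto simp: F_def)
    also have "\<dots> = (\<Sum>f\<in>?X - {e}. frag_cmul (sg ?S e) (frag_cmul (sg (insert e ?S) f) (multi_diff {e, f} s)))"
      by (intro sum.cong) (auto simp: F_def)
    finally show "frag_cmul (sg ?S e) (frag_extend (state_diff G r) (partial_diff G e s)) = (\<Sum>f\<in>?X. F e f)"
      using e by (simp add: inner frag_cmul_sum)
  qed simp
  finally have eq: "diff G r (state_diff G r s) = (\<Sum>e\<in>?X. \<Sum>f\<in>?X. F e f)" .
  have anti: "F e f = - F f e" if "e \<in> ?X" "f \<in> ?X" for e f
  proof (cases "e = f")
    case False
    have "(e, f) \<in> r \<longleftrightarrow> (f, e) \<notin> r"
      using r that False unfolding linear_order_on_def partial_order_on_def total_on_def antisym_def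
      by auto
    then have "sg ?S e * sg (insert e ?S) f = - (sg ?S f * sg (insert f ?S) e)"
      using that False fS by (auto simp: sg_def preceding_insert)
    then show ?thesis using False by (simp add: F_def insert_commute)
  qed (simp add: F_def)
  have "(\<Sum>e\<in>?X. \<Sum>f\<in>?X. F e f) = (\<Sum>f\<in>?X. \<Sum>e\<in>?X. F e f)" by (rule sum.swap)
  also have "\<dots> = (\<Sum>f\<in>?X. \<Sum>e\<in>?X. - F f e)"
    by (intro sum.cong refl anti)
  also have "\<dots> = - (\<Sum>f\<in>?X. \<Sum>e\<in>?X. F f e)"
    by (simp add: sum_negf)
  finally show ?thesis using eq eq_uminus_imp_zero by metis
qed

lemma keys_state_diff:
  assumes "s \<in> graded_states G m i j"
  shows "Poly_Mapping.keys (state_diff G r s) \<subseteq> graded_states G (Suc m) i j"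
proof -
  have s: "s \<in> enhanced_states G" using assms by (simp add: graded_states_def)
  have "Poly_Mapping.keys (frag_cmul c (partial_diff G e s)) \<subseteq> graded_states G (Suc m) i j"
    if "e \<in> edges G - state_edges s" for e c
    using keys_multi_diff[OF assms, of "{e}"] that keys_cmul[of c]
    by (auto simp: partial_diff_eq_multi_diff[OF s])
  then have "state_diff G r s \<in> carrier (free_Abelian_group (graded_states G (Suc m) i j))"
    unfolding state_diff_def by (intro sum_closed_free_Abelian_group) simp
  then show ?thesis by simp
qed

lemma diff_hom: "diff G r \<in> hom (chain_group G m i j) (chain_group G (Suc m) i j)"
proof (rule homI)
  fix c assume "c \<in> carrier (chain_group G m i j)"
  then have "Poly_Mapping.keys c \<subseteq> graded_states G m i j" by (simp add: chain_group_def)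
  then have "Poly_Mapping.keys (diff G r c) \<subseteq> graded_states G (Suc m) i j"
    unfolding diff_def using keys_frag_extend[of "state_diff G r" c] keys_state_diff by fastforce
  then show "diff G r c \<in> carrier (chain_group G (Suc m) i j)" by (simp add: chain_group_def)
qed (simp add: chain_group_def diff_def frag_extend_add)

lemma diff_diff:
  assumes "c \<in> carrier (chain_group G m i j)" "linear_order_on (edges G) r"
  shows "diff G r (diff G r c) = 0"
proof -
  have "Poly_Mapping.keys c \<subseteq> enhanced_states G"
    using assms(1) by (auto simp: chain_group_def graded_states_def)
  then show ?thesis
  proof (induction c rule: frag_induction)
    case (one s)
    then show ?case using diff_state_diff[OF _ assms(2)] by (simp add: diff_def)
  qed (simp_all add: diff_def frag_extend_diff)
qed

end

section \<open>The Euler characteristic of the homology\<close>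

lemma (in comm_group) rank_on_one: "rank_on G {\<one>} = 0"
proof -
  have "int_independent G {}" by (simp add: int_independent_def)
  moreover have "int_depends G {} \<one>"
    unfolding int_depends_def by (rule exI[of _ 1]) simp
  ultimately show ?thesis using rank_on_eqI(1)[of "{}" "{\<one>}"] by simp
qed

lemma alternating_sum_telescope:
  fixes b :: "nat \<Rightarrow> int"
  shows "(\<Sum>m\<le>N. (- 1) ^ m * (b (Suc m) + b m)) = b 0 + (- 1) ^ N * b (Suc N)"
  by (induction N) (auto simp: algebra_simps)

context finite_graph
begin

lemma enhanced_states_eq_image:
  "enhanced_states G = (\<lambda>(S, l, y). Enhanced_State S l y) `
     (SIGMA S : Pow (edges G). (components G S \<rightarrow>\<^sub>E {1, label_x}) \<times> (S \<rightarrow>\<^sub>E {Edge_one, Edge_y}))"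
proof (intro equalityI subsetI)
  fix s assume "s \<in> enhanced_states G"
  then show "s \<in> (\<lambda>(S, l, y). Enhanced_State S l y) `
     (SIGMA S : Pow (edges G). (components G S \<rightarrow>\<^sub>E {1, label_x}) \<times> (S \<rightarrow>\<^sub>E {Edge_one, Edge_y}))"
    by (intro image_eqI[of _ _ "(state_edges s, component_label s, edge_label s)"])
      (auto simp: enhanced_states_def)
qed (auto simp: enhanced_states_def)

lemma finite_subgraph: "S \<subseteq> edges G \<Longrightarrow> finite S"
  using finite_edges by (rule finite_subset[rotated])

lemma finite_enhanced_states: "finite (enhanced_states G)"
  unfolding enhanced_states_eq_image
  by (intro finite_imageI finite_SigmaI finite_cartesian_product finite_PiE)
    (auto simp: finite_edges finite_components intro: finite_subgraph)

lemma finite_graded_states: "finite (graded_states G m i j)"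
  using finite_enhanced_states by (auto simp: graded_states_def intro: finite_subset[rotated])

lemma card_state_edges_le: "s \<in> enhanced_states G \<Longrightarrow> card (state_edges s) \<le> card (edges G)"
  using state_edges_subset finite_edges by (intro card_mono)

lemma comm_group_chain_group: "comm_group (chain_group G m i j)"
  by (simp add: chain_group_def abelian_free_Abelian_group)

lemma group_hom_diff: "group_hom (chain_group G m i j) (chain_group G (Suc m) i j) (diff G r)"
  using diff_hom by (simp add: group_hom_def group_hom_axioms_def chain_group_def)

lemma subgroup_cycles: "subgroup (cycles G r m i j) (chain_group G m i j)"
  unfolding cycles_def by (rule group_hom.subgroup_kernel[OF group_hom_diff])

lemma subgroup_boundaries: "subgroup (boundaries G r m i j) (chain_group G m i j)"
proof (cases m)
  case 0
  have "group (chain_group G m i j)" by (simp add: chain_group_def)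
  from group.triv_subgroup[OF this] show ?thesis by (simp add: 0 boundaries_def chain_group_def)
next
  case (Suc l)
  then show ?thesis
    using group_hom.img_is_subgroup[OF group_hom_diff] by (simp add: boundaries_def)
qed

lemma boundaries_subset_cycles:
  assumes "linear_order_on (edges G) r"
  shows "boundaries G r m i j \<subseteq> cycles G r m i j"
proof
  fix b assume b: "b \<in> boundaries G r m i j"
  then have "b \<in> carrier (chain_group G m i j)"
    using subgroup.subset[OF subgroup_boundaries] by blast
  moreover have "diff G r b = 0"
  proof (cases m)
    case 0
    then show ?thesis using b by (simp add: boundaries_def diff_def)
  next
    case (Suc l)
    then show ?thesis using b diff_diff[OF _ assms] by (auto simp: boundaries_def)
  qed
  ultimately show "b \<in> cycles G r m i j" by (simp add: cycles_def kernel_def chain_group_def)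
qed

text \<open>The rank of a chain group is that of its cycles plus that of the boundaries one degree higher, and
  the rank of the cycles is that of the boundaries plus that of the homology.\<close>

lemma rank_homology:
  fixes i j :: nat
  assumes "linear_order_on (edges G) r"
  defines "b l \<equiv> rank_on (chain_group G l i j) (boundaries G r l i j)"
  shows "card (graded_states G m i j)
    = b m + group_rank (dichromatic_homology G r m i j) + b (Suc m)"
proof -
  let ?C = "chain_group G m i j" and ?C' = "chain_group G (Suc m) i j"
  let ?Z = "cycles G r m i j"
  have fin: "finite_rank_on ?C (carrier ?C)" and rC: "rank_on ?C (carrier ?C) = card (graded_states G m i j)"
    using rank_on_free_Abelian_group[OF finite_graded_states] by (simp_all add: chain_group_def)
  have "rank_on ?C (carrier ?C)
      = rank_on ?C {x \<in> carrier ?C. diff G r x = \<one>\<^bsub>?C'\<^esub>} + rank_on ?C' (diff G r ` carrier ?C)"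
    using comm_group_chain_group diff_hom fin
    by (intro rank_on_kernel_image group.subgroup_self) (simp_all add: chain_group_def)
  then have "card (graded_states G m i j) = rank_on ?C ?Z + b (Suc m)"
    by (simp add: rC b_def boundaries_def cycles_def kernel_def)
  moreover have "finite_rank_on ?C ?Z"
    using comm_group.finite_rank_on_mono[OF comm_group_chain_group fin] subgroup.subset[OF subgroup_cycles] .
  then have "rank_on ?C ?Z = b m + group_rank (dichromatic_homology G r m i j)"
    unfolding b_def dichromatic_homology_def
    by (intro group_rank_quotient comm_group_chain_group subgroup_cycles subgroup_boundaries
        boundaries_subset_cycles assms(1))
  ultimately show ?thesis by simp
qed

lemma homology_euler_char_eq:
  assumes "linear_order_on (edges G) r"
  shows "homology_euler_char G r i j
    = (\<Sum>s | s \<in> enhanced_states G \<and> y_count s = i \<and> x_count G s = j. (- 1) ^ card (state_edges s))"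
proof -
  define N where "N = card (edges G)"
  define b where "b l = rank_on (chain_group G l i j) (boundaries G r l i j)" for l
  define c where "c m = card (graded_states G m i j)" for m
  define h where "h m = group_rank (dichromatic_homology G r m i j)" for m
  have c: "c m = b m + h m + b (Suc m)" for m
    unfolding b_def c_def h_def by (rule rank_homology[OF assms])
  have c0: "c m = 0" if "m > N" for m
  proof -
    have "card (state_edges s) \<noteq> m" if "s \<in> enhanced_states G" for s
      using card_state_edges_le[OF that] \<open>m > N\<close> by (simp add: N_def)
    then have "graded_states G m i j = {}" by (auto simp: graded_states_def)
    then show ?thesis by (simp add: c_def)
  qed
  have b0: "b 0 = 0"
    using comm_group.rank_on_one[OF comm_group_chain_group]
    by (simp add: b_def boundaries_def chain_group_def)
  \<comment> \<open>There are no chains, hence no boundaries, in degree \<open>N + 1\<close>.\<close>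
  have bN: "b (Suc N) = 0" using c[of "Suc N"] c0[of "Suc N"] by simp
  have "homology_euler_char G r i j = (\<Sum>m\<le>N. (- 1) ^ m * int (h m))"
    unfolding homology_euler_char_def h_def[symmetric]
  proof (rule Sum_any.expand_superset)
    show "{m. (- 1) ^ m * int (h m) \<noteq> 0} \<subseteq> {..N}"
    proof
      fix m assume "m \<in> {m. (- 1) ^ m * int (h m) \<noteq> 0}"
      then have "c m \<noteq> 0" using c[of m] by auto
      then show "m \<in> {..N}" using c0[of m] by (cases "m \<le> N") auto
    qed
  qed simp
  also have "\<dots> = (\<Sum>m\<le>N. (- 1) ^ m * int (c m) - (- 1) ^ m * (int (b (Suc m)) + int (b m)))"
    by (intro sum.cong) (auto simp: c algebra_simps)
  also have "\<dots> = (\<Sum>m\<le>N. (- 1) ^ m * int (c m))"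
    using alternating_sum_telescope[of "\<lambda>m. int (b m)" N] by (simp add: sum_subtractf b0 bN)
  also have "\<dots> = (\<Sum>m\<le>N. \<Sum>s | s \<in> {s \<in> enhanced_states G. y_count s = i \<and> x_count G s = j}
      \<and> card (state_edges s) = m. (- 1) ^ card (state_edges s))"
  proof (rule sum.cong)
    fix m
    have "{s \<in> {s \<in> enhanced_states G. y_count s = i \<and> x_count G s = j}. card (state_edges s) = m}
        = graded_states G m i j"
      by (auto simp: graded_states_def)
    moreover have "(\<Sum>s\<in>graded_states G m i j. (- 1) ^ card (state_edges s)) = (- 1) ^ m * int (c m)"
      by (simp add: c_def graded_states_def)
    ultimately show "(- 1) ^ m * int (c m)
        = (\<Sum>s | s \<in> {s \<in> enhanced_states G. y_count s = i \<and> x_count G s = j}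
            \<and> card (state_edges s) = m. (- 1) ^ card (state_edges s))"
      by simp
  qed simp
  also have "\<dots> = (\<Sum>s\<in>{s \<in> enhanced_states G. y_count s = i \<and> x_count G s = j}.
      (- 1) ^ card (state_edges s))"
    using finite_enhanced_states card_state_edges_le by (intro sum.group) (auto simp: N_def)
  finally show ?thesis by simp
qed

end

section \<open>Generating functions of states\<close>

text \<open>Generating function of the labellings of \<open>A\<close> by \<open>a\<close> and \<open>b\<close>, counting the occurrences of \<open>b\<close>.\<close>

lemma sum_two_labelings:
  fixes q :: real
  assumes "finite A" "a \<noteq> b"
  shows "(\<Sum>f\<in>A \<rightarrow>\<^sub>E {a, b}. q ^ card {x \<in> A. f x = b}) = (1 + q) ^ card A"
proof -
  have "(1 + q) ^ card A = (\<Prod>x\<in>A. \<Sum>y\<in>{a, b}. if y = b then q else 1)"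
    using assms by simp
  also have "\<dots> = (\<Sum>f\<in>A \<rightarrow>\<^sub>E {a, b}. \<Prod>x\<in>A. if f x = b then q else 1)"
    using assms by (intro prod_sum_PiE) auto
  also have "\<dots> = (\<Sum>f\<in>A \<rightarrow>\<^sub>E {a, b}. q ^ card {x \<in> A. f x = b})"
    using assms(1) by (intro sum.cong) (auto simp: prod.If_cases Int_def)
  finally show ?thesis by simp
qed

context finite_graph
begin

lemma dichromatic_eq_sum_states:
  "dichromatic G p q
    = (\<Sum>s\<in>enhanced_states G. p ^ y_count s * q ^ x_count G s * (- 1) ^ card (state_edges s))"
proof -
  let ?L = "\<lambda>S. components G S \<rightarrow>\<^sub>E {1, label_x}" and ?Y = "\<lambda>S. S \<rightarrow>\<^sub>E {Edge_one, Edge_y}"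
  have "(\<Sum>s\<in>enhanced_states G. p ^ y_count s * q ^ x_count G s * (- 1) ^ card (state_edges s))
      = (\<Sum>(S, l, y)\<in>(SIGMA S : Pow (edges G). ?L S \<times> ?Y S).
          p ^ card {e \<in> S. y e = Edge_y} * q ^ card {C \<in> components G S. l C = label_x} * (- 1) ^ card S)"
    unfolding enhanced_states_eq_image
    by (subst sum.reindex) (auto simp: inj_on_def y_count_def x_count_def intro!: sum.cong)
  also have "\<dots> = (\<Sum>S\<in>Pow (edges G). \<Sum>(l, y)\<in>?L S \<times> ?Y S.
          p ^ card {e \<in> S. y e = Edge_y} * q ^ card {C \<in> components G S. l C = label_x} * (- 1) ^ card S)"
    by (subst sum.Sigma)
      (auto simp: finite_edges finite_components split_def intro!: finite_cartesian_product finite_PiE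
        intro: finite_subgraph)
  also have "\<dots> = (\<Sum>S\<in>Pow (edges G). (- 1) ^ card S
      * (\<Sum>y\<in>?Y S. p ^ card {e \<in> S. y e = Edge_y})
      * (\<Sum>l\<in>?L S. q ^ card {C \<in> components G S. l C = label_x}))"
  proof (rule sum.cong)
    fix S
    show "(\<Sum>(l, y)\<in>?L S \<times> ?Y S.
          p ^ card {e \<in> S. y e = Edge_y} * q ^ card {C \<in> components G S. l C = label_x} * (- 1) ^ card S)
      = (- 1) ^ card S * (\<Sum>y\<in>?Y S. p ^ card {e \<in> S. y e = Edge_y})
      * (\<Sum>l\<in>?L S. q ^ card {C \<in> components G S. l C = label_x})"
      by (simp add: sum.cartesian_product[symmetric] sum_product sum_distrib_left sum_distrib_right mult_ac)
        (subst sum.swap, simp)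
  qed simp
  also have "\<dots> = dichromatic G p q"
    unfolding dichromatic_def
    using label_x_neq_1 finite_components finite_subgraph
    by (intro sum.cong) (auto simp: sum_two_labelings)
  finally show ?thesis by simp
qed

lemma dichromatic_eq_graded_euler_char:
  assumes "linear_order_on (edges G) r"
  shows "dichromatic G p q
    = Sum_any (\<lambda>(i, j). p ^ i * q ^ j * real_of_int (homology_euler_char G r i j))"
proof -
  define deg where "deg s = (y_count s, x_count G s)" for s :: "('v, 'e) enhanced_state"
  let ?K = "deg ` enhanced_states G"
  have chi: "homology_euler_char G r i j
      = (\<Sum>s | s \<in> enhanced_states G \<and> deg s = (i, j). (- 1) ^ card (state_edges s))" for i j
    using homology_euler_char_eq[OF assms] by (simp add: deg_def)
  have "Sum_any (\<lambda>(i, j). p ^ i * q ^ j * real_of_int (homology_euler_char G r i j))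
      = (\<Sum>(i, j)\<in>?K. p ^ i * q ^ j * real_of_int (homology_euler_char G r i j))"
  proof (rule Sum_any.expand_superset)
    show "{a. (case a of (i, j) \<Rightarrow> p ^ i * q ^ j * real_of_int (homology_euler_char G r i j)) \<noteq> 0} \<subseteq> ?K"
    proof clarify
      fix i j assume "p ^ i * q ^ j * real_of_int (homology_euler_char G r i j) \<noteq> 0"
      then have "homology_euler_char G r i j \<noteq> 0" by auto
      then have "{s \<in> enhanced_states G. deg s = (i, j)} \<noteq> {}" unfolding chi by (metis sum.empty)
      then show "(i, j) \<in> ?K" by force
    qed
  qed (simp add: finite_enhanced_states)
  also have "\<dots> = (\<Sum>d\<in>?K. \<Sum>s | s \<in> enhanced_states G \<and> deg s = d.
      p ^ y_count s * q ^ x_count G s * (- 1) ^ card (state_edges s))"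
    by (intro sum.cong) (auto simp: chi sum_distrib_left deg_def intro!: sum.cong)
  also have "\<dots> = (\<Sum>s\<in>enhanced_states G.
      p ^ y_count s * q ^ x_count G s * (- 1) ^ card (state_edges s))"
    by (intro sum.group) (auto simp: finite_enhanced_states)
  finally show ?thesis by (simp add: dichromatic_eq_sum_states)
qed

section \<open>The Potts partition function\<close>

text \<open>Both ends of \<open>e\<close> have the same spin; always true for a loop.\<close>

definition monochromatic :: "('v \<Rightarrow> nat) \<Rightarrow> 'e \<Rightarrow> bool" where
  "monochromatic \<sigma> e \<longleftrightarrow> (\<exists>i j. ends G e = Upair i j \<and> \<sigma> i = \<sigma> j)"

lemma monochromatic_conn:
  assumes "\<forall>e\<in>S. monochromatic \<sigma> e" "(u, v) \<in> conn S"
  shows "\<sigma> u = \<sigma> v"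
  using assms(2)
proof (induction rule: rtrancl_induct)
  case (step y z)
  then obtain e where "e \<in> S" "ends G e = Upair y z" by (auto simp: adjacency_def)
  then have "\<sigma> y = \<sigma> z" using assms(1) by (force simp: monochromatic_def)
  then show ?case using step by simp
qed simp

lemma card_monochromatic_colorings:
  assumes "S \<subseteq> edges G"
  shows "card {\<sigma> \<in> nodes G \<rightarrow>\<^sub>E {1..n}. \<forall>e\<in>S. monochromatic \<sigma> e} = n ^ card (components G S)"
proof -
  let ?cls = "\<lambda>v. conn S `` {v}"
  define f where "f \<tau> = (\<lambda>v\<in>nodes G. \<tau> (?cls v))" for \<tau> :: "'v set \<Rightarrow> nat"
  have cls: "?cls v \<in> components G S" if "v \<in> nodes G" for v
    using that by (auto simp: components_conv)
  have "inj_on f (components G S \<rightarrow>\<^sub>E {1..n})"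
  proof (rule inj_onI)
    fix \<tau> \<tau>' assume t: "\<tau> \<in> components G S \<rightarrow>\<^sub>E {1..n}" "\<tau>' \<in> components G S \<rightarrow>\<^sub>E {1..n}" "f \<tau> = f \<tau>'"
    have "\<tau> C = \<tau>' C" if C: "C \<in> components G S" for C
    proof -
      from C obtain v where v: "v \<in> nodes G" "C = ?cls v" by (auto simp: components_conv)
      then show ?thesis using fun_cong[OF t(3), of v] by (simp add: f_def)
    qed
    with t(1,2) show "\<tau> = \<tau>'" by (rule PiE_ext)
  qed
  moreover have "f ` (components G S \<rightarrow>\<^sub>E {1..n}) = {\<sigma> \<in> nodes G \<rightarrow>\<^sub>E {1..n}. \<forall>e\<in>S. monochromatic \<sigma> e}"
  proof (intro equalityI subsetI)
    fix \<sigma> assume "\<sigma> \<in> f ` (components G S \<rightarrow>\<^sub>E {1..n})"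
    then obtain \<tau> where t: "\<tau> \<in> components G S \<rightarrow>\<^sub>E {1..n}" "\<sigma> = f \<tau>" by blast
    have "monochromatic \<sigma> e" if e: "e \<in> S" for e
    proof -
      obtain u v where uv: "ends G e = Upair u v" "u \<in> nodes G" "v \<in> nodes G"
        using assms e by (blast elim: edge_ends)
      then have "(u, v) \<in> adjacency G S" using e by (auto simp: adjacency_def)
      then have "?cls u = ?cls v" by (intro conn_class_eq) auto
      then have "\<sigma> u = \<sigma> v" using uv by (simp add: t(2) f_def)
      then show ?thesis using uv(1) unfolding monochromatic_def by blast
    qed
    moreover have "\<sigma> \<in> nodes G \<rightarrow>\<^sub>E {1..n}"
      using t cls unfolding f_def by auto
    ultimately show "\<sigma> \<in> {\<sigma> \<in> nodes G \<rightarrow>\<^sub>E {1..n}. \<forall>e\<in>S. monochromatic \<sigma> e}" by blast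
  next
    fix \<sigma> assume s: "\<sigma> \<in> {\<sigma> \<in> nodes G \<rightarrow>\<^sub>E {1..n}. \<forall>e\<in>S. monochromatic \<sigma> e}"
    define \<tau> where "\<tau> = (\<lambda>C\<in>components G S. \<sigma> (SOME v. v \<in> C))"
    have tau: "\<tau> (?cls v) = \<sigma> v" if "v \<in> nodes G" for v
    proof -
      have "(SOME w. w \<in> ?cls v) \<in> ?cls v" by (rule someI[of _ v]) simp
      then have "(v, SOME w. w \<in> ?cls v) \<in> conn S" by simp
      then have "\<sigma> v = \<sigma> (SOME w. w \<in> ?cls v)" using s by (intro monochromatic_conn) auto
      then show ?thesis using cls[OF that] by (simp add: \<tau>_def)
    qed
    have "\<tau> \<in> components G S \<rightarrow>\<^sub>E {1..n}"
    proof (rule PiE_I)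
      fix C assume "C \<in> components G S"
      then obtain v where "v \<in> nodes G" "C = ?cls v" by (auto simp: components_conv)
      then show "\<tau> C \<in> {1..n}" using tau s by auto
    qed (simp add: \<tau>_def)
    moreover have "\<sigma> = f \<tau>"
      using s tau by (auto simp: f_def fun_eq_iff PiE_iff extensional_def)
    ultimately show "\<sigma> \<in> f ` (components G S \<rightarrow>\<^sub>E {1..n})" by blast
  qed
  ultimately have "card (components G S \<rightarrow>\<^sub>E {1..n})
      = card {\<sigma> \<in> nodes G \<rightarrow>\<^sub>E {1..n}. \<forall>e\<in>S. monochromatic \<sigma> e}"
    by (metis card_image)
  then show ?thesis by (simp add: card_PiE finite_components)
qed

lemma boltzmann_weight_expansion:
  fixes k T :: real
  defines "w \<equiv> exp (- 1 / (k * T))"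
  shows "exp (- potts_energy G \<sigma> / (k * T))
    = (\<Sum>S\<in>Pow (edges G). if \<forall>e\<in>S. monochromatic \<sigma> e then (w - 1) ^ card S else 0)"
proof -
  have "- potts_energy G \<sigma> / (k * T)
      = (\<Sum>e\<in>edges G. - (if monochromatic \<sigma> e then 1 else 0) / (k * T))"
    unfolding potts_energy_def monochromatic_def[symmetric]
    by (simp only: sum_negf[symmetric] sum_divide_distrib)
  also have "\<dots> = (\<Sum>e\<in>edges G. if monochromatic \<sigma> e then - 1 / (k * T) else 0)"
    by (intro sum.cong) auto
  finally have "exp (- potts_energy G \<sigma> / (k * T))
      = exp (\<Sum>e\<in>edges G. if monochromatic \<sigma> e then - 1 / (k * T) else 0)"
    by (rule arg_cong)
  also have "\<dots> = (\<Prod>e\<in>edges G. (if monochromatic \<sigma> e then w - 1 else 0) + 1)"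
    by (subst exp_sum[OF finite_edges]) (auto simp: w_def intro!: prod.cong)
  also have "\<dots> = (\<Sum>S\<in>Pow (edges G). \<Prod>e\<in>S. if monochromatic \<sigma> e then w - 1 else 0)"
    by (subst prod_add[OF finite_edges]) simp
  also have "\<dots> = (\<Sum>S\<in>Pow (edges G). if \<forall>e\<in>S. monochromatic \<sigma> e then (w - 1) ^ card S else 0)"
  proof (rule sum.cong)
    fix S assume "S \<in> Pow (edges G)"
    then have "finite S" using finite_subgraph by simp
    then show "(\<Prod>e\<in>S. if monochromatic \<sigma> e then w - 1 else 0)
        = (if \<forall>e\<in>S. monochromatic \<sigma> e then (w - 1) ^ card S else 0)"
      by (auto intro: prod_zero)
  qed simp
  finally show ?thesis .
qed

lemma potts_eq_dichromatic:
  "potts_partition G n k T = dichromatic G (- exp (- 1 / (k * T))) (real n - 1)"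
proof -
  define w where "w = exp (- 1 / (k * T))"
  let ?X = "nodes G \<rightarrow>\<^sub>E {1..n}"
  have fX: "finite ?X" using finite_nodes by (intro finite_PiE) auto
  have "potts_partition G n k T
      = (\<Sum>S\<in>Pow (edges G). \<Sum>\<sigma>\<in>?X. if \<forall>e\<in>S. monochromatic \<sigma> e then (w - 1) ^ card S else 0)"
    unfolding potts_partition_def boltzmann_weight_expansion w_def by (rule sum.swap)
  also have "\<dots> = (\<Sum>S\<in>Pow (edges G). real n ^ card (components G S) * (w - 1) ^ card S)"
  proof (rule sum.cong)
    fix S assume "S \<in> Pow (edges G)"
    then have "card {\<sigma> \<in> ?X. \<forall>e\<in>S. monochromatic \<sigma> e} = n ^ card (components G S)"
      by (intro card_monochromatic_colorings) simp
    then have "real (card {\<sigma> \<in> ?X. \<forall>e\<in>S. monochromatic \<sigma> e}) = real n ^ card (components G S)"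
      by simp
    moreover have "(\<Sum>\<sigma>\<in>?X. if \<forall>e\<in>S. monochromatic \<sigma> e then (w - 1) ^ card S else 0)
        = real (card {\<sigma> \<in> ?X. \<forall>e\<in>S. monochromatic \<sigma> e}) * (w - 1) ^ card S"
      using fX by (simp add: sum.If_cases Int_def)
    ultimately show "(\<Sum>\<sigma>\<in>?X. if \<forall>e\<in>S. monochromatic \<sigma> e then (w - 1) ^ card S else 0)
        = real n ^ card (components G S) * (w - 1) ^ card S" by simp
  qed simp
  also have "\<dots> = dichromatic G (- w) (real n - 1)"
  proof -
    have "(w - 1) ^ m = (- 1) ^ m * (1 + - w) ^ m" for m
      by (simp flip: power_mult_distrib)
    then show ?thesis unfolding dichromatic_def by (intro sum.cong) (simp_all add: mult_ac)
  qed
  finally show ?thesis by (simp add: w_def)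
qed

end

theorem mainTheorem5:
  fixes G :: "('v, 'e) multigraph"
    and r :: "('e \<times> 'e) set"
    and n :: nat
    and k T :: real
  assumes "finite_multigraph G"
    and "linear_order_on (edges G) r"
    and "n > 0" and "k > 0" and "T > 0"
  shows "potts_partition G n k T = dichromatic G (- exp (- 1 / (k * T))) (real n - 1) \<and>
    dichromatic G (- exp (- 1 / (k * T))) (real n - 1) =
      Sum_any (\<lambda>(i, j). (- 1) ^ i * exp (- 1 / (k * T)) ^ i * (real n - 1) ^ j
                          * real_of_int (homology_euler_char G r i j))"
proof -
  interpret finite_graph G by unfold_locales fact
  have sign: "(- exp (- 1 / (k * T))) ^ i = (- 1) ^ i * exp (- 1 / (k * T)) ^ i" for i
    by (rule power_minus)
  show ?thesis
    using potts_eq_dichromatic dichromatic_eq_graded_euler_char[OF assms(2)]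
    unfolding sign[symmetric] by blast
qed

end
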